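(* Let $\Gamma$ be a countable group acting without inversion on a non-trivial tree, and let $(\mathcal{G},\{\Gamma_p\}_{p\in \mathrm{V}(\mathcal{G})},\{\Sigma_e\}_{e\in \mathrm{E}(\mathcal{G})})$ be the associated graph of groups structure on the quotient graph $\mathcal{G}$, with source maps $s_e:\Sigma_e\to\Gamma_{s(e)}$, so that $\Gamma$ is isomorphic to its fundamental group. If $\Gamma_p$ is infinite for all $p\in \mathrm{V}(\mathcal{G})$ and $s_e(\Sigma_e)$ is highly core-free in $\Gamma_{s(e)}$ for all $e\in \mathrm{E}(\mathcal{G})$, then $\Gamma$ admits a faithful and highly transitive action on an infinite countable set.
   Context: Graphs and trees are in the sense of Serre: each edge $e$ has a source $s(e)$, a range $r(e)$ and an inverse edge $\overline{e}\neq e$ with $\overline{\overline e}=e$, $s(\overline{e})=r(e)$. A group acts without inversion if no element maps an edge $e$ to $\overline{e}$. A tree is non-trivial if it has at least two edges, $e$ and its inverse edge $\overline{e}$. By Bass-Serre theory, for a group $\Gamma$ acting without inversion on a tree, the quotient graph $\mathcal{G}$ (vertex set $\mathrm{V}(\mathcal{G})$, edge set $\mathrm{E}(\mathcal{G})$) carries a graph of groups structure: groups $\Gamma_p$ for $p\in\mathrm{V}(\mathcal{G})$, each isomorphic to a vertex stabilizer; groups $\Sigma_e=\Sigma_{\overline{e}}$ for $e\in\mathrm{E}(\mathcal{G})$, each isomorphic to an edge stabilizer; injective homomorphisms $s_e:\Sigma_e\to\Gamma_{s(e)}$ and $r_e=s_{\overline{e}}:\Sigma_e\to\Gamma_{r(e)}$;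 and $\Gamma$ is isomorphic to the fundamental group of this graph of groups, i.e., given a fixed maximal subtree $\mathcal{T}\subset\mathcal{G}$, the group generated by the groups $\Gamma_p$ ($p\in\mathrm{V}(\mathcal{G})$) and the edges $e\in\mathrm{E}(\mathcal{G})$ with relations $\overline{e}=e^{-1}$, $s_e(x)=e\,r_e(x)\,e^{-1}$ for all $x\in\Sigma_e$, and $e=1$ for all edges $e$ of $\mathcal{T}$. For a subgroup $\Sigma<H$ and $S\subset H$, put $\mathrm{Core}_S(\Sigma)=\bigcap_{h\in S}h^{-1}\Sigma h$. A subgroup $\Sigma<H$ is highly core-free if, for every finite subset $F\subset H$, every $n\geq 1$ and all non-empty subsets $S_1,\dots,S_n\subset H$ with $H\setminus\Sigma F\subset\bigcup_{k=1}^n S_k$, there exists $1\leq k\leq n$ such that $\mathrm{Core}_{S_k}(\Sigma)=\{1\}$. An action of a countable group $\Gamma$ on an infinite countable set $X$ is highly transitive if for all $n\geq 1$, for any pairwise distinct $x_1,\dots,x_n\in X$ and any pairwise distinct $y_1,\dots,y_n\in X$ there is $g\in\Gamma$ with $gx_k=y_k$ for all $k$. An action is faithful if only $1\in\Gamma$ acts as the identity. *)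

theory Defs
  imports "HOL-Algebra.Group_Action" "HOL-Library.Countable_Set"
begin

section \<open>Graphs and trees in the sense of Serre\<close>

record ('v, 'e) sgraph =
  verts :: "'v set"
  edges :: "'e set"
  src :: "'e \<Rightarrow> 'v"
  rng :: "'e \<Rightarrow> 'v"
  einv :: "'e \<Rightarrow> 'e"

definition serre_graph :: "('v, 'e) sgraph \<Rightarrow> bool" where
  "serre_graph G \<longleftrightarrow>
     (\<forall>e\<in>edges G. src G e \<in> verts G \<and> rng G e \<in> verts G \<and> einv G e \<in> edges G
        \<and> einv G e \<noteq> e \<and> einv G (einv G e) = e \<and> src G (einv G e) = rng G e)"

fun gpath :: "('v, 'e) sgraph \<Rightarrow> 'v \<Rightarrow> 'e list \<Rightarrow> 'v \<Rightarrow> bool" where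
  "gpath G u [] v \<longleftrightarrow> u \<in> verts G \<and> u = v"
| "gpath G u (e # es) v \<longleftrightarrow> e \<in> edges G \<and> src G e = u \<and> gpath G (rng G e) es v"

definition gconnected :: "('v, 'e) sgraph \<Rightarrow> bool" where
  "gconnected G \<longleftrightarrow> (\<forall>u\<in>verts G. \<forall>v\<in>verts G. \<exists>es. gpath G u es v)"

text \<open>
  A circuit is an injective image of an oriented \<open>n\<close>-cycle with \<open>n \<ge> 1\<close>: the vertices passed
  are distinct and no edge is used together with its inverse. Loops are circuits of length 1,
  pairs of parallel edges give circuits of length 2.
\<close>
definition circuit :: "('v, 'e) sgraph \<Rightarrow> 'e list \<Rightarrow> bool" where
  "circuit G es \<longleftrightarrow> es \<noteq> [] \<and> (\<exists>u. gpath G u es u) \<and> distinct (map (src G) es)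
     \<and> (\<forall>e\<in>set es. einv G e \<notin> set es)"

definition gtree :: "('v, 'e) sgraph \<Rightarrow> bool" where
  "gtree G \<longleftrightarrow> serre_graph G \<and> verts G \<noteq> {} \<and> gconnected G \<and> (\<nexists>es. circuit G es)"

text \<open>A single edge \<open>e\<close> already yields the two edges \<open>e\<close> and \<open>einv G e\<close>.\<close>
definition nontrivial_tree :: "('v, 'e) sgraph \<Rightarrow> bool" where
  "nontrivial_tree G \<longleftrightarrow> gtree G \<and> edges G \<noteq> {}"

definition subgraph :: "('v, 'e) sgraph \<Rightarrow> ('v, 'e) sgraph \<Rightarrow> bool" where
  "subgraph T G \<longleftrightarrow> serre_graph T \<and> verts T \<subseteq> verts G \<and> edges T \<subseteq> edges G
     \<and> (\<forall>e\<in>edges T. src T e = src G e \<and> rng T e = rng G e \<and> einv T e = einv G e)"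

definition maximal_subtree :: "('v, 'e) sgraph \<Rightarrow> ('v, 'e) sgraph \<Rightarrow> bool" where
  "maximal_subtree T G \<longleftrightarrow> gtree T \<and> subgraph T G
     \<and> (\<forall>T'. gtree T' \<and> subgraph T' G \<and> verts T \<subseteq> verts T' \<and> edges T \<subseteq> edges T'
          \<longrightarrow> verts T' = verts T \<and> edges T' = edges T)"


section \<open>Group actions on graphs and the quotient graph\<close>

definition acts_on_graph ::
  "'g monoid \<Rightarrow> ('v, 'e) sgraph \<Rightarrow> ('g \<Rightarrow> 'v \<Rightarrow> 'v) \<Rightarrow> ('g \<Rightarrow> 'e \<Rightarrow> 'e) \<Rightarrow> bool" where
  "acts_on_graph \<Gamma> X \<alpha> \<beta> \<longleftrightarrow> group_action \<Gamma> (verts X) \<alpha> \<and> group_action \<Gamma> (edges X) \<beta>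
     \<and> (\<forall>g\<in>carrier \<Gamma>. \<forall>e\<in>edges X. src X (\<beta> g e) = \<alpha> g (src X e)
          \<and> rng X (\<beta> g e) = \<alpha> g (rng X e) \<and> einv X (\<beta> g e) = \<beta> g (einv X e))"

definition without_inversion ::
  "'g monoid \<Rightarrow> ('v, 'e) sgraph \<Rightarrow> ('g \<Rightarrow> 'e \<Rightarrow> 'e) \<Rightarrow> bool" where
  "without_inversion \<Gamma> X \<beta> \<longleftrightarrow> (\<forall>g\<in>carrier \<Gamma>. \<forall>e\<in>edges X. \<beta> g e \<noteq> einv X e)"

text \<open>
  Vertices and edges are the orbits. By equivariance, the set of sources of the edges in an edge
  orbit is a vertex orbit, and likewise for ranges and inverses, so that the structure maps are
  direct images.
\<close>
definition quotient_graph ::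
  "'g monoid \<Rightarrow> ('v, 'e) sgraph \<Rightarrow> ('g \<Rightarrow> 'v \<Rightarrow> 'v) \<Rightarrow> ('g \<Rightarrow> 'e \<Rightarrow> 'e) \<Rightarrow> ('v set, 'e set) sgraph"
  where
  "quotient_graph \<Gamma> X \<alpha> \<beta> =
     \<lparr>verts = orbits \<Gamma> (verts X) \<alpha>, edges = orbits \<Gamma> (edges X) \<beta>,
      src = (\<lambda>d. src X ` d), rng = (\<lambda>d. rng X ` d), einv = (\<lambda>d. einv X ` d)\<rparr>"

lemma serre_graph_quotient_graph:
  assumes X: "serre_graph X" and act: "acts_on_graph \<Gamma> X \<alpha> \<beta>" and "without_inversion \<Gamma> X \<beta>"
  shows "serre_graph (quotient_graph \<Gamma> X \<alpha> \<beta>)"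
proof -
  interpret e: group_action \<Gamma> "edges X" \<beta> using act by (simp add: acts_on_graph_def)
  have s: "src X ` orbit \<Gamma> \<beta> e = orbit \<Gamma> \<alpha> (src X e)"
    and r: "rng X ` orbit \<Gamma> \<beta> e = orbit \<Gamma> \<alpha> (rng X e)"
    and i: "einv X ` orbit \<Gamma> \<beta> e = orbit \<Gamma> \<beta> (einv X e)" if "e \<in> edges X" for e
    using act that unfolding acts_on_graph_def orbit_def by (auto simp: image_iff) metis+
  have ne: "orbit \<Gamma> \<beta> (einv X e) \<noteq> orbit \<Gamma> \<beta> e" if "e \<in> edges X" for e
  proof
    assume "orbit \<Gamma> \<beta> (einv X e) = orbit \<Gamma> \<beta> e"
    moreover have "einv X e \<in> edges X" using X that by (auto simp: serre_graph_def)
    ultimately have "einv X e \<in> orbit \<Gamma> \<beta> e" using e.orbit_refl by blast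
    then show False using assms(3) that by (force simp: orbit_def without_inversion_def)
  qed
  have X': "src X e \<in> verts X" "rng X e \<in> verts X" "einv X e \<in> edges X"
    "einv X (einv X e) = e" "src X (einv X e) = rng X e" if "e \<in> edges X" for e
    using X that by (auto simp: serre_graph_def)
  have orb: "u \<in> verts X \<Longrightarrow> orbit \<Gamma> \<alpha> u \<in> orbits \<Gamma> (verts X) \<alpha>"
    "e \<in> edges X \<Longrightarrow> orbit \<Gamma> \<beta> e \<in> orbits \<Gamma> (edges X) \<beta>" for u e
    by (auto simp: orbits_def)
  show ?thesis
    unfolding serre_graph_def
  proof
    fix d assume "d \<in> edges (quotient_graph \<Gamma> X \<alpha> \<beta>)"
    then obtain e where e: "e \<in> edges X" "d = orbit \<Gamma> \<beta> e"
      by (auto simp: quotient_graph_def orbits_def)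
    show "src (quotient_graph \<Gamma> X \<alpha> \<beta>) d \<in> verts (quotient_graph \<Gamma> X \<alpha> \<beta>)
        \<and> rng (quotient_graph \<Gamma> X \<alpha> \<beta>) d \<in> verts (quotient_graph \<Gamma> X \<alpha> \<beta>)
        \<and> einv (quotient_graph \<Gamma> X \<alpha> \<beta>) d \<in> edges (quotient_graph \<Gamma> X \<alpha> \<beta>)
        \<and> einv (quotient_graph \<Gamma> X \<alpha> \<beta>) d \<noteq> d
        \<and> einv (quotient_graph \<Gamma> X \<alpha> \<beta>) (einv (quotient_graph \<Gamma> X \<alpha> \<beta>) d) = d
        \<and> src (quotient_graph \<Gamma> X \<alpha> \<beta>) (einv (quotient_graph \<Gamma> X \<alpha> \<beta>) d)
            = rng (quotient_graph \<Gamma> X \<alpha> \<beta>) d"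
      using e ne X' by (simp add: quotient_graph_def s r i orb e(2) del: image_image)
  qed
qed


section \<open>Graphs of groups\<close>

record ('p, 'd, 'h, 'k) gog =
  vgrp :: "'p \<Rightarrow> 'h monoid"
  egrp :: "'d \<Rightarrow> 'k monoid"
  smap :: "'d \<Rightarrow> 'k \<Rightarrow> 'h"

definition graph_of_groups :: "('p, 'd) sgraph \<Rightarrow> ('p, 'd, 'h, 'k) gog \<Rightarrow> bool" where
  "graph_of_groups Y \<G> \<longleftrightarrow> serre_graph Y \<and> (\<forall>p\<in>verts Y. group (vgrp \<G> p))
     \<and> (\<forall>e\<in>edges Y. group (egrp \<G> e) \<and> egrp \<G> (einv Y e) = egrp \<G> e
          \<and> smap \<G> e \<in> hom (egrp \<G> e) (vgrp \<G> (src Y e))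
          \<and> inj_on (smap \<G> e) (carrier (egrp \<G> e)))"

abbreviation rmap :: "('p, 'd) sgraph \<Rightarrow> ('p, 'd, 'h, 'k) gog \<Rightarrow> 'd \<Rightarrow> 'k \<Rightarrow> 'h" where
  "rmap Y \<G> e \<equiv> smap \<G> (einv Y e)"

subsection \<open>The fundamental group\<close>

datatype ('p, 'h, 'd) letter = VLetter 'p 'h | ELetter 'd

definition letters :: "('p, 'd) sgraph \<Rightarrow> ('p, 'd, 'h, 'k) gog \<Rightarrow> ('p, 'h, 'd) letter set" where
  "letters Y \<G> = {VLetter p a | p a. p \<in> verts Y \<and> a \<in> carrier (vgrp \<G> p)} \<union> ELetter ` edges Y"

text \<open>
  The set of letters is closed under formal inversion (of elements of vertex groups and of edges),
  so the group presented by the generators and relations is the quotient of the free monoid on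
  the letters by the congruence generated by the relations. The first two relations
  are those of the vertex groups, the third one says that \<open>einv Y e\<close> is inverse to \<open>e\<close>.
\<close>
inductive fg_rel ::
  "('p, 'd) sgraph \<Rightarrow> ('p, 'd, 'h, 'k) gog \<Rightarrow> ('p, 'd) sgraph
     \<Rightarrow> ('p, 'h, 'd) letter list \<Rightarrow> ('p, 'h, 'd) letter list \<Rightarrow> bool"
  for Y \<G> T where
  vmult: "\<lbrakk>p \<in> verts Y; a \<in> carrier (vgrp \<G> p); b \<in> carrier (vgrp \<G> p)\<rbrakk>
     \<Longrightarrow> fg_rel Y \<G> T [VLetter p a, VLetter p b] [VLetter p (a \<otimes>\<^bsub>vgrp \<G> p\<^esub> b)]"
| vone: "p \<in> verts Y \<Longrightarrow> fg_rel Y \<G> T [VLetter p \<one>\<^bsub>vgrp \<G> p\<^esub>] []"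
| einverse: "e \<in> edges Y \<Longrightarrow> fg_rel Y \<G> T [ELetter e, ELetter (einv Y e)] []"
| econj: "\<lbrakk>e \<in> edges Y; x \<in> carrier (egrp \<G> e)\<rbrakk>
     \<Longrightarrow> fg_rel Y \<G> T [VLetter (src Y e) (smap \<G> e x)]
           [ELetter e, VLetter (rng Y e) (rmap Y \<G> e x), ELetter (einv Y e)]"
| etree: "e \<in> edges T \<Longrightarrow> fg_rel Y \<G> T [ELetter e] []"
| refl: "w \<in> lists (letters Y \<G>) \<Longrightarrow> fg_rel Y \<G> T w w"
| sym: "fg_rel Y \<G> T v w \<Longrightarrow> fg_rel Y \<G> T w v"
| trans: "\<lbrakk>fg_rel Y \<G> T u v; fg_rel Y \<G> T v w\<rbrakk> \<Longrightarrow> fg_rel Y \<G> T u w"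
| append: "\<lbrakk>fg_rel Y \<G> T u u'; fg_rel Y \<G> T v v'\<rbrakk> \<Longrightarrow> fg_rel Y \<G> T (u @ v) (u' @ v')"

definition fg_class ::
  "('p, 'd) sgraph \<Rightarrow> ('p, 'd, 'h, 'k) gog \<Rightarrow> ('p, 'd) sgraph
     \<Rightarrow> ('p, 'h, 'd) letter list \<Rightarrow> ('p, 'h, 'd) letter list set" where
  "fg_class Y \<G> T w = {w'. fg_rel Y \<G> T w w'}"

definition fundamental_group ::
  "('p, 'd) sgraph \<Rightarrow> ('p, 'd, 'h, 'k) gog \<Rightarrow> ('p, 'd) sgraph \<Rightarrow> ('p, 'h, 'd) letter list set monoid"
  where
  "fundamental_group Y \<G> T =
     \<lparr>carrier = fg_class Y \<G> T ` lists (letters Y \<G>),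
      mult = (\<lambda>A B. \<Union>u\<in>A. \<Union>v\<in>B. fg_class Y \<G> T (u @ v)),
      one = fg_class Y \<G> T []\<rparr>"

lemma fg_class_mult:
  assumes "u \<in> lists (letters Y \<G>)" "v \<in> lists (letters Y \<G>)"
  shows "fg_class Y \<G> T u \<otimes>\<^bsub>fundamental_group Y \<G> T\<^esub> fg_class Y \<G> T v = fg_class Y \<G> T (u @ v)"
  using fg_rel.refl[OF assms(1), of T] fg_rel.refl[OF assms(2), of T]
  unfolding fundamental_group_def fg_class_def
  by simp (blast intro: fg_rel.append fg_rel.sym fg_rel.trans)

lemma group_fundamental_group:
  assumes G: "graph_of_groups Y \<G>"
  shows "group (fundamental_group Y \<G> T)"
proof -
  let ?L = "lists (letters Y \<G>)"
  have left_inv: "\<exists>v\<in>?L. fg_rel Y \<G> T (v @ w) []" if "w \<in> ?L" for w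
    using that
  proof (induction w)
    case Nil
    show ?case by (rule bexI[of _ "[]"]) (auto intro: fg_rel.refl)
  next
    case (Cons l w)
    then obtain v where v: "v \<in> ?L" "fg_rel Y \<G> T (v @ w) []" by auto
    obtain k where k: "k \<in> letters Y \<G>" "fg_rel Y \<G> T [k, l] []"
    proof (cases l)
      case (VLetter p a)
      then have pa: "p \<in> verts Y" "a \<in> carrier (vgrp \<G> p)"
        using Cons.hyps by (auto simp: letters_def)
      then interpret group "vgrp \<G> p" using G by (simp add: graph_of_groups_def)
      have "fg_rel Y \<G> T [VLetter p (inv\<^bsub>vgrp \<G> p\<^esub> a), l] []"
        using fg_rel.vmult[OF pa(1) inv_closed[OF pa(2)] pa(2), of T] fg_rel.vone[OF pa(1), where T = T] pa(2)
        unfolding VLetter by (auto intro: fg_rel.trans)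
      then show ?thesis
        using pa by (intro that[of "VLetter p (inv\<^bsub>vgrp \<G> p\<^esub> a)"]) (auto simp: letters_def)
    next
      case (ELetter e)
      then have e: "e \<in> edges Y" using Cons.hyps by (auto simp: letters_def)
      then have "einv Y e \<in> edges Y" "einv Y (einv Y e) = e"
        using G by (auto simp: graph_of_groups_def serre_graph_def)
      then have "fg_rel Y \<G> T [ELetter (einv Y e), l] []"
        using fg_rel.einverse[of "einv Y e" Y \<G> T] ELetter by simp
      then show ?thesis using that \<open>einv Y e \<in> edges Y\<close> by (auto simp: letters_def)
    qed
    have "fg_rel Y \<G> T ((v @ [k, l]) @ w) ((v @ []) @ w)"
      using k v Cons.hyps by (intro fg_rel.append fg_rel.refl) auto
    then show ?case
      using v k by (intro bexI[of _ "v @ [k]"]) (auto intro: fg_rel.trans)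
  qed
  have eq: "fg_class Y \<G> T u = fg_class Y \<G> T v" if "fg_rel Y \<G> T u v" for u v
    using that by (auto simp: fg_class_def intro: fg_rel.sym fg_rel.trans)
  have one: "\<one>\<^bsub>fundamental_group Y \<G> T\<^esub> = fg_class Y \<G> T []"
    and car: "carrier (fundamental_group Y \<G> T) = fg_class Y \<G> T ` ?L"
    by (auto simp: fundamental_group_def)
  have nil: "[] \<in> ?L" by simp
  have app: "u @ v \<in> ?L" if "u \<in> ?L" "v \<in> ?L" for u v using that by simp
  show ?thesis
  proof (rule groupI)
    fix x assume "x \<in> carrier (fundamental_group Y \<G> T)"
    then obtain w where w: "w \<in> ?L" "x = fg_class Y \<G> T w" unfolding car by blast
    then obtain v where v: "v \<in> ?L" "fg_rel Y \<G> T (v @ w) []" using left_inv by blast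
    show "\<exists>y\<in>carrier (fundamental_group Y \<G> T).
        y \<otimes>\<^bsub>fundamental_group Y \<G> T\<^esub> x = \<one>\<^bsub>fundamental_group Y \<G> T\<^esub>"
      unfolding car one w(2) using fg_class_mult[OF v(1) w(1)] eq[OF v(2)] v(1) by blast
    show "\<one>\<^bsub>fundamental_group Y \<G> T\<^esub> \<otimes>\<^bsub>fundamental_group Y \<G> T\<^esub> x = x"
      unfolding one w(2) fg_class_mult[OF nil w(1)] by simp
    fix y assume "y \<in> carrier (fundamental_group Y \<G> T)"
    then obtain u where u: "u \<in> ?L" "y = fg_class Y \<G> T u" unfolding car by blast
    show "x \<otimes>\<^bsub>fundamental_group Y \<G> T\<^esub> y \<in> carrier (fundamental_group Y \<G> T)"
      unfolding car w(2) u(2) fg_class_mult[OF w(1) u(1)] using app[OF w(1) u(1)] by blast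
    fix z assume "z \<in> carrier (fundamental_group Y \<G> T)"
    then obtain z' where z: "z' \<in> ?L" "z = fg_class Y \<G> T z'" unfolding car by blast
    show "x \<otimes>\<^bsub>fundamental_group Y \<G> T\<^esub> y \<otimes>\<^bsub>fundamental_group Y \<G> T\<^esub> z
        = x \<otimes>\<^bsub>fundamental_group Y \<G> T\<^esub> (y \<otimes>\<^bsub>fundamental_group Y \<G> T\<^esub> z)"
      unfolding w(2) u(2) z(2) fg_class_mult[OF w(1) u(1)] fg_class_mult[OF u(1) z(1)]
        fg_class_mult[OF app[OF w(1) u(1)] z(1)] fg_class_mult[OF w(1) app[OF u(1) z(1)]]
      by simp
  next
    show "\<one>\<^bsub>fundamental_group Y \<G> T\<^esub> \<in> carrier (fundamental_group Y \<G> T)"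
      unfolding car one using nil by blast
  qed
qed

subsection \<open>The graph of groups associated with an action on a tree\<close>

text \<open>
  The choices of the Bass-Serre construction: a maximal subtree \<open>T\<close> of the quotient graph,
  representatives \<open>v p\<close> of the vertex orbits and \<open>x e\<close> of the edge orbits, and elements \<open>t e\<close>
  of the group such that \<open>x e\<close> starts at \<open>v (src e)\<close> and ends at \<open>t e\<close> times \<open>v (rng e)\<close>.
  Since \<open>t e = \<one>\<close> for the edges \<open>e\<close> of \<open>T\<close>, the tree \<open>T\<close> is lifted by \<open>v\<close> and \<open>x\<close>.
  The vertex group at \<open>p\<close> is identified by \<open>\<phi> p\<close> with the stabilizer of \<open>v p\<close>, the edge
  group at \<open>e\<close> by \<open>\<phi> (src e) \<circ> smap e\<close> with the stabilizer of \<open>x e\<close>; the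
  range map is then the inclusion of the latter, conjugated by \<open>t e\<close>.
\<close>
definition bass_serre_data ::
  "'g monoid \<Rightarrow> ('v, 'e) sgraph \<Rightarrow> ('g \<Rightarrow> 'v \<Rightarrow> 'v) \<Rightarrow> ('g \<Rightarrow> 'e \<Rightarrow> 'e)
     \<Rightarrow> ('v set, 'e set, 'h, 'k) gog \<Rightarrow> ('v set, 'e set) sgraph
     \<Rightarrow> ('v set \<Rightarrow> 'v) \<Rightarrow> ('e set \<Rightarrow> 'e) \<Rightarrow> ('e set \<Rightarrow> 'g) \<Rightarrow> ('v set \<Rightarrow> 'h \<Rightarrow> 'g) \<Rightarrow> bool"
  where
  "bass_serre_data \<Gamma> X \<alpha> \<beta> \<G> T v x t \<phi> \<longleftrightarrow>
    (let Y = quotient_graph \<Gamma> X \<alpha> \<beta> in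
       maximal_subtree T Y
     \<and> (\<forall>p\<in>verts Y. v p \<in> p
          \<and> \<phi> p \<in> iso (vgrp \<G> p) (\<Gamma>\<lparr>carrier := stabilizer \<Gamma> \<alpha> (v p)\<rparr>))
     \<and> (\<forall>e\<in>edges Y. x e \<in> e \<and> t e \<in> carrier \<Gamma>
          \<and> src X (x e) = v (src Y e) \<and> rng X (x e) = \<alpha> (t e) (v (rng Y e))
          \<and> t (einv Y e) = inv\<^bsub>\<Gamma>\<^esub> t e \<and> x (einv Y e) = \<beta> (inv\<^bsub>\<Gamma>\<^esub> t e) (einv X (x e))
          \<and> \<phi> (src Y e) \<circ> smap \<G> e \<in> iso (egrp \<G> e) (\<Gamma>\<lparr>carrier := stabilizer \<Gamma> \<beta> (x e)\<rparr>)
          \<and> (\<forall>a\<in>carrier (egrp \<G> e). \<phi> (src Y e) (smap \<G> e a)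
                = t e \<otimes>\<^bsub>\<Gamma>\<^esub> \<phi> (rng Y e) (rmap Y \<G> e a) \<otimes>\<^bsub>\<Gamma>\<^esub> inv\<^bsub>\<Gamma>\<^esub> t e))
     \<and> (\<forall>e\<in>edges T. t e = \<one>\<^bsub>\<Gamma>\<^esub>))"

text \<open>
  The existence of the isomorphism \<open>h\<close> is the structure theorem of Bass and Serre: it holds for all
  choices as above, and is part of what is meant by the graph of groups structure of an action.
\<close>
definition associated_graph_of_groups ::
  "'g monoid \<Rightarrow> ('v, 'e) sgraph \<Rightarrow> ('g \<Rightarrow> 'v \<Rightarrow> 'v) \<Rightarrow> ('g \<Rightarrow> 'e \<Rightarrow> 'e)
     \<Rightarrow> ('v set, 'e set, 'h, 'k) gog \<Rightarrow> bool" where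
  "associated_graph_of_groups \<Gamma> X \<alpha> \<beta> \<G> \<longleftrightarrow>
    (let Y = quotient_graph \<Gamma> X \<alpha> \<beta> in
       graph_of_groups Y \<G>
     \<and> (\<exists>T v x t \<phi>. bass_serre_data \<Gamma> X \<alpha> \<beta> \<G> T v x t \<phi>
          \<and> (\<exists>h \<in> iso (fundamental_group Y \<G> T) \<Gamma>.
               (\<forall>p\<in>verts Y. \<forall>a\<in>carrier (vgrp \<G> p). h (fg_class Y \<G> T [VLetter p a]) = \<phi> p a)
             \<and> (\<forall>e\<in>edges Y. h (fg_class Y \<G> T [ELetter e]) = t e))))"


section \<open>Highly core-free subgroups and highly transitive actions\<close>

definition Core :: "'a monoid \<Rightarrow> 'a set \<Rightarrow> 'a set \<Rightarrow> 'a set" where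
  "Core H S \<Sigma> = (\<Inter>h\<in>S. {inv\<^bsub>H\<^esub> h \<otimes>\<^bsub>H\<^esub> a \<otimes>\<^bsub>H\<^esub> h | a. a \<in> \<Sigma>})"

definition highly_core_free :: "'a set \<Rightarrow> 'a monoid \<Rightarrow> bool" where
  "highly_core_free \<Sigma> H \<longleftrightarrow> subgroup \<Sigma> H \<and>
     (\<forall>F n S. finite F \<and> F \<subseteq> carrier H \<and> n \<ge> 1
        \<and> (\<forall>k\<in>{1..n::nat}. S k \<noteq> {} \<and> S k \<subseteq> carrier H)
        \<and> carrier H - (\<Sigma> <#>\<^bsub>H\<^esub> F) \<subseteq> (\<Union>k\<in>{1..n}. S k)
        \<longrightarrow> (\<exists>k\<in>{1..n}. Core H (S k) \<Sigma> = {\<one>\<^bsub>H\<^esub>}))"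

definition highly_transitive :: "'g monoid \<Rightarrow> 'x set \<Rightarrow> ('g \<Rightarrow> 'x \<Rightarrow> 'x) \<Rightarrow> bool" where
  "highly_transitive \<Gamma> A \<psi> \<longleftrightarrow> group_action \<Gamma> A \<psi> \<and>
     (\<forall>n\<ge>1. \<forall>x y. inj_on x {1..n::nat} \<and> x ` {1..n} \<subseteq> A \<and> inj_on y {1..n} \<and> y ` {1..n} \<subseteq> A
        \<longrightarrow> (\<exists>g\<in>carrier \<Gamma>. \<forall>k\<in>{1..n}. \<psi> g (x k) = y k))"

end

theory Submission
  imports Defs
begin

text \<open>
  Fix one edge \<open>e0\<close> of the tree, with stabilizer \<open>\<Sigma>\<close>, and let \<open>\<Gamma>\<close> act freely on \<open>\<nat>\<close> with
  infinitely many orbits. A \<open>\<Sigma>\<close>-equivariant permutation \<open>\<sigma>\<close> of \<open>\<nat>\<close> attaches to every edge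
  \<open>g e0\<close> the permutation \<open>g \<sigma> g\<inverse>\<close>, to its inverse edge the inverse permutation, and to the
  edges outside these orbits the identity. In a tree, the product of these permutations along a
  path depends only on its end points; therefore \<open>g\<close> acting as \<open>P(p, g p) \<circ> g\<close>, where \<open>P(p, g p)\<close>
  is the product from the source \<open>p\<close> of \<open>e0\<close> to \<open>g p\<close>, is a new action. Elements of the
  stabilizer of \<open>p\<close> act as before and elements \<open>k\<close> of the stabilizer of the range of \<open>e0\<close> act as
  \<open>\<sigma> k \<sigma>\<inverse>\<close>. No presentation of \<open>\<Gamma>\<close> is needed.

  A generic \<open>\<sigma>\<close>, built from finite approximations, gives a faithful and highly transitive action.
  High core-freeness yields \<open>h\<close> and \<open>h'\<close> fixing \<open>p\<close> such that all the points \<open>h x\<^sub>i\<close> and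
  \<open>h' y\<^sub>i\<close> lie in distinct \<open>\<Sigma>\<close>-orbits on which \<open>\<sigma>\<inverse>\<close> is still undecided; setting
  \<open>\<sigma>\<inverse> (h x\<^sub>i) = z\<^sub>i\<close> and \<open>\<sigma>\<inverse> (h' y\<^sub>i) = k z\<^sub>i\<close> for new points \<open>z\<^sub>i\<close> and some
  \<open>k \<notin> \<Sigma>\<close> fixing the range of \<open>e0\<close>, the element \<open>h'\<inverse> k h\<close> maps \<open>x\<^sub>i\<close> to \<open>y\<^sub>i\<close>.
\<close>

section \<open>Paths in trees\<close>

lemma serre_graphD:
  assumes "serre_graph X" "e \<in> edges X"
  shows "src X e \<in> verts X" "rng X e \<in> verts X" "einv X e \<in> edges X" "einv X e \<noteq> e"
    "einv X (einv X e) = e" "src X (einv X e) = rng X e" "rng X (einv X e) = src X e"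
proof -
  have *: "e \<in> edges X \<Longrightarrow> src X e \<in> verts X \<and> rng X e \<in> verts X \<and> einv X e \<in> edges X
        \<and> einv X e \<noteq> e \<and> einv X (einv X e) = e \<and> src X (einv X e) = rng X e" for e
    using assms(1) unfolding serre_graph_def by blast
  show "src X e \<in> verts X" "rng X e \<in> verts X" "einv X e \<in> edges X" "einv X e \<noteq> e"
    "einv X (einv X e) = e" "src X (einv X e) = rng X e"
    using *[OF assms(2)] by auto
  show "rng X (einv X e) = src X e"
    using *[OF assms(2)] *[of "einv X e"] by simp
qed

lemma gpath_verts:
  assumes "serre_graph X" "gpath X u es v"
  shows "u \<in> verts X" "v \<in> verts X"
  using assms(2) by (induction es arbitrary: u) (use serre_graphD[OF assms(1)] in auto)

lemma gpath_append:
  assumes "serre_graph X"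
  shows "gpath X u (es @ fs) w \<longleftrightarrow> (\<exists>v. gpath X u es v \<and> gpath X v fs w)"
  by (induction es arbitrary: u) (use gpath_verts(1)[OF assms] in auto)

lemma gpath_edges: "gpath X u es v \<Longrightarrow> set es \<subseteq> edges X"
  by (induction es arbitrary: u) auto

lemma gpath_rev:
  assumes X: "serre_graph X" and "gpath X u es v"
  shows "gpath X v (rev (map (einv X) es)) u"
  using assms(2)
proof (induction es arbitrary: u)
  case (Cons e es)
  then have "gpath X (rng X e) [einv X e] u"
    using serre_graphD[OF X] by auto
  then show ?case using Cons by (auto simp: gpath_append[OF X])
qed simp

lemma gpath_nth_rng:
  assumes "gpath X u es v" "Suc i < length es"
  shows "rng X (es ! i) = src X (es ! Suc i)"
  using assms
proof (induction es arbitrary: u i)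
  case (Cons e es)
  then show ?case by (cases i; cases es) auto
qed simp

text \<open>If no vertex is left twice, the absence of circuits puts some edge and its inverse on
  the path, and distinctness of the sources makes them adjacent. Otherwise the stretch between two
  visits to a vertex is a shorter closed path, and induction applies.\<close>

lemma closed_gpath_backtracks:
  assumes X: "gtree X" and "gpath X u es u" "es \<noteq> []"
  shows "\<exists>A e B. es = A @ e # einv X e # B"
  using assms(2,3)
proof (induction "length es" arbitrary: u es rule: less_induct)
  case less
  have S: "serre_graph X" using X by (simp add: gtree_def)
  note edg = gpath_edges[OF less.prems(1)]
  show ?case
  proof (cases "distinct (map (src X) es)")
    case True
    have "\<not> circuit X es" using X by (auto simp: gtree_def)
    then obtain e where e: "e \<in> set es" "einv X e \<in> set es"
      using True less.prems by (auto simp: circuit_def)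
    obtain i j where ij: "i < length es" "j < length es" "es ! i = e" "es ! j = einv X e"
      using e by (meson in_set_conv_nth)
    have inv: "einv X e \<noteq> e" "einv X (einv X e) = e" "src X (einv X e) = rng X e"
      "src X e = rng X (einv X e)"
      using serre_graphD[OF S, of e] e edg by auto
    have *: "\<exists>A e B. es = A @ e # einv X e # B"
      if "m < n" "n < length es" "es ! n = einv X (es ! m)" "src X (es ! n) = rng X (es ! m)" for m n
    proof -
      have "src X (es ! n) = src X (es ! Suc m)"
        using gpath_nth_rng[OF less.prems(1), of m] that by simp
      then have n: "n = Suc m"
        using True that nth_eq_iff_index_eq[OF True, of n "Suc m"] by simp
      have "es = take m es @ es ! m # es ! Suc m # drop (Suc (Suc m)) es"
        using that(1,2) unfolding n by (simp add: Cons_nth_drop_Suc)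
      then show ?thesis using that(3) n by metis
    qed
    have "i \<noteq> j" using ij inv by auto
    then show ?thesis
      using *[of i j] *[of j i] ij inv by (metis linorder_neqE_nat)
  next
    case False
    then obtain A B C y where "map (src X) es = A @ [y] @ B @ [y] @ C"
      using not_distinct_decomp by blast
    then obtain A' e B' e' C' where es: "es = A' @ e # B' @ e' # C'" and y: "src X e = y" "src X e' = y"
      by (auto simp: map_eq_append_conv map_eq_Cons_conv append_eq_map_conv Cons_eq_map_conv)
    have "gpath X y (e # B') y"
      using less.prems(1) y unfolding es by (auto simp: gpath_append[OF S])
    then obtain A2 f B2 where "e # B' = A2 @ f # einv X f # B2"
      using less.hyps[of "e # B'" y] es by auto
    then have "es = (A' @ A2) @ f # einv X f # (B2 @ e' # C')" by (simp add: es)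
    then show ?thesis by blast
  qed
qed

text \<open>A path of least length works: between an edge and a later occurrence of its inverse it
  returns to the same vertex, so this detour could be cut out.\<close>

lemma minimal_gpath:
  assumes X: "serre_graph X" and "gpath X u es0 v"
  obtains es where "gpath X u es v" "\<And>A e B. es = A @ e # B \<Longrightarrow> einv X e \<notin> set B"
proof -
  obtain es where es: "gpath X u es v" "\<And>fs. gpath X u fs v \<Longrightarrow> length es \<le> length fs"
    using assms(2) exists_least_iff[of "\<lambda>n. \<exists>es. gpath X u es v \<and> length es = n"]
    by (metis (mono_tags, lifting) not_less)
  have "einv X e \<notin> set B" if AB: "es = A @ e # B" for A e B
  proof
    assume "einv X e \<in> set B"
    then obtain C D where B: "B = C @ einv X e # D" by (meson split_list)
    have "rng X (einv X e) = src X e"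
      using serre_graphD(7)[OF X, of e] gpath_edges[OF es(1)] AB by auto
    then have "gpath X u (A @ D) v"
      using es(1) unfolding AB B by (auto simp: gpath_append[OF X])
    from es(2)[OF this] show False by (simp add: AB B)
  qed
  with es(1) show ?thesis by (rule that)
qed

section \<open>Products of edge permutations along paths\<close>

primrec path_map :: "('e \<Rightarrow> 'x \<Rightarrow> 'x) \<Rightarrow> 'e list \<Rightarrow> 'x \<Rightarrow> 'x" where
  "path_map S [] = id"
| "path_map S (e # es) = S e \<circ> path_map S es"

lemma path_map_append: "path_map S (es @ fs) = path_map S es \<circ> path_map S fs"
  by (induction es) (auto simp: comp_assoc)

text \<open>Cancelling a backtrack \<open>e\<close>, \<open>einv X e\<close> leaves a shorter closed
  path with the same product.\<close>

lemma path_map_closed: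
  assumes X: "gtree X" and S: "\<And>e. e \<in> edges X \<Longrightarrow> S e \<circ> S (einv X e) = id"
    and "gpath X u es u"
  shows "path_map S es = id"
  using assms(3)
proof (induction "length es" arbitrary: es rule: less_induct)
  case less
  have sg: "serre_graph X" using X by (simp add: gtree_def)
  show ?case
  proof (cases "es = []")
    case False
    then obtain A e B where es: "es = A @ e # einv X e # B"
      using closed_gpath_backtracks[OF X less.prems] by blast
    have e: "e \<in> edges X" using gpath_edges[OF less.prems] es by auto
    then have "rng X (einv X e) = src X e"
      using serre_graphD(7)[OF sg] by simp
    then have "gpath X u (A @ B) u"
      using less.prems unfolding es by (auto simp: gpath_append[OF sg])
    then have "path_map S (A @ B) = id" using less.hyps es by simp
    moreover have "path_map S es = path_map S A \<circ> (S e \<circ> S (einv X e)) \<circ> path_map S B"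
      by (simp add: es path_map_append comp_assoc)
    ultimately show ?thesis using S[OF e] by (simp add: path_map_append)
  qed simp
qed

lemma path_map_rev:
  assumes "\<And>e. e \<in> edges X \<Longrightarrow> S (einv X e) \<circ> S e = id" "set es \<subseteq> edges X"
  shows "path_map S (rev (map (einv X) es)) \<circ> path_map S es = id"
  using assms(2)
proof (induction es)
  case (Cons e es)
  then have e: "S (einv X e) \<circ> S e = id" using assms(1) by simp
  have "path_map S (rev (map (einv X) (e # es))) \<circ> path_map S (e # es)
      = path_map S (rev (map (einv X) es)) \<circ> (S (einv X e) \<circ> S e) \<circ> path_map S es"
    by (simp add: path_map_append comp_assoc)
  also have "\<dots> = path_map S (rev (map (einv X) es)) \<circ> path_map S es"
    unfolding e by simp
  also have "\<dots> = id" using Cons by (intro Cons.IH) simp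
  finally show ?case .
qed simp

text \<open>One path followed by the reverse of the other is closed, so its product is the identity,
  and \<open>path_map_rev\<close> cancels the reversed factor.\<close>

lemma path_map_unique:
  assumes X: "gtree X" and S: "\<And>e. e \<in> edges X \<Longrightarrow> S e \<circ> S (einv X e) = id"
    and es: "gpath X u es v" and fs: "gpath X u fs v"
  shows "path_map S es = path_map S fs"
proof -
  have sg: "serre_graph X" using X by (simp add: gtree_def)
  have S': "S (einv X e) \<circ> S e = id" if "e \<in> edges X" for e
    using S[of "einv X e"] serre_graphD[OF sg that] by simp
  have "gpath X u (es @ rev (map (einv X) fs)) u"
    using es gpath_rev[OF sg fs] by (auto simp: gpath_append[OF sg])
  then have "path_map S es \<circ> path_map S (rev (map (einv X) fs)) = id"
    unfolding path_map_append[symmetric] using path_map_closed[where S = S, OF X S] by blast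
  then have "path_map S es \<circ> (path_map S (rev (map (einv X) fs)) \<circ> path_map S fs) = path_map S fs"
    by (simp add: comp_assoc[symmetric])
  then show ?thesis using path_map_rev[of X S, OF S' gpath_edges[OF fs]] by simp
qed

section \<open>Generic equivariant permutations\<close>

text \<open>\<open>a_fresh\<close> is the form in which infinitely many orbits are used: it supplies
  points outside the \<Gamma>-orbits of any finite set. \<open>\<Sigma>\<close> will be the
  stabilizer of the chosen edge.\<close>

locale free_action_subgroup = group \<Gamma> for \<Gamma> (structure) +
  fixes a :: "'g \<Rightarrow> 'x::countable \<Rightarrow> 'x" and \<Sigma> :: "'g set"
  assumes subgroup_\<Sigma>: "subgroup \<Sigma> \<Gamma>"
    and a_one: "a \<one> x = x"
    and a_mult: "\<lbrakk>g \<in> carrier \<Gamma>; h \<in> carrier \<Gamma>\<rbrakk> \<Longrightarrow> a (g \<otimes> h) x = a g (a h x)"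
    and a_free: "\<lbrakk>g \<in> carrier \<Gamma>; a g x = x\<rbrakk> \<Longrightarrow> g = \<one>"
    and a_fresh: "finite F \<Longrightarrow> \<exists>z. \<forall>y\<in>F. \<forall>g\<in>carrier \<Gamma>. a g y \<noteq> z"
begin

lemma \<Sigma>_carrier: "s \<in> \<Sigma> \<Longrightarrow> s \<in> carrier \<Gamma>"
  using subgroup.mem_carrier[OF subgroup_\<Sigma>] .

lemma a_inv: "g \<in> carrier \<Gamma> \<Longrightarrow> a (inv g) (a g x) = x" "g \<in> carrier \<Gamma> \<Longrightarrow> a g (a (inv g) x) = x"
  by (simp_all add: a_mult[symmetric] a_one)

lemma a_eq_iff: "g \<in> carrier \<Gamma> \<Longrightarrow> a g x = y \<longleftrightarrow> x = a (inv g) y"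
  using a_inv by metis

lemma a_inject: "\<lbrakk>g \<in> carrier \<Gamma>; h \<in> carrier \<Gamma>; a g x = a h x\<rbrakk> \<Longrightarrow> g = h"
  using a_free[of "inv h \<otimes> g" x] by (simp add: a_mult a_inv) (metis inv_closed inv_equality inv_inv)

definition sim :: "'x \<Rightarrow> 'x \<Rightarrow> bool" where
  "sim x y \<longleftrightarrow> (\<exists>s\<in>\<Sigma>. y = a s x)"

lemma sim_refl: "sim x x"
  unfolding sim_def using subgroup.one_closed[OF subgroup_\<Sigma>] a_one by metis

lemma sim_sym: "sim x y \<Longrightarrow> sim y x"
  unfolding sim_def using subgroup.m_inv_closed[OF subgroup_\<Sigma>] a_inv \<Sigma>_carrier by metis

text \<open>
  A finite set \<open>C\<close> of pairs is a condition if it extends to the graph of an injective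
  \<open>\<Sigma>\<close>-equivariant map on the union of the \<open>\<Sigma>\<close>-orbits of its domain.
\<close>
definition condition :: "('x \<times> 'x) set \<Rightarrow> bool" where
  "condition C \<longleftrightarrow> finite C \<and>
     (\<forall>x y x' y' s. (x, y) \<in> C \<and> (x', y') \<in> C \<and> s \<in> \<Sigma> \<longrightarrow> (x' = a s x \<longleftrightarrow> y' = a s y))"

lemma condition_finite: "condition C \<Longrightarrow> finite C"
  unfolding condition_def by blast

text \<open>Both coordinates of the new pair lie in \<Sigma>-orbits not met before, so for mixed
  pairs neither side of the equivalence holds; for the new pair with itself, freeness reduces both
  sides to \<open>s = \<one>\<close>.\<close>

lemma condition_insert:
  assumes C: "condition C" and x: "\<And>u. u \<in> Domain C \<Longrightarrow> \<not> sim u x"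
    and y: "\<And>v. v \<in> Range C \<Longrightarrow> \<not> sim v y"
  shows "condition (insert (x, y) C)"
proof -
  have "x' = a s u \<longleftrightarrow> y' = a s v"
    if *: "(u, v) \<in> insert (x, y) C" "(x', y') \<in> insert (x, y) C" "s \<in> \<Sigma>" for u v x' y' s
  proof -
    consider "(u, v) = (x, y)" "(x', y') = (x, y)" | "(u, v) = (x, y)" "(x', y') \<in> C"
      | "(u, v) \<in> C" "(x', y') = (x, y)" | "(u, v) \<in> C" "(x', y') \<in> C"
      using *(1,2) by blast
    then show ?thesis
    proof cases
      case 1
      then show ?thesis using a_free[of s] \<Sigma>_carrier[OF *(3)] a_one by (metis Pair_inject)
    next
      case 2
      then have "\<not> sim x x'" "\<not> sim y y'" using x y sim_sym by blast+
      then show ?thesis using 2 *(3) by (auto simp: sim_def)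
    next
      case 3
      then have "\<not> sim u x'" "\<not> sim v y'" using x y by blast+
      then show ?thesis using *(3) by (auto simp: sim_def)
    next
      case 4
      then show ?thesis using C *(3) by (auto simp: condition_def)
    qed
  qed
  then show ?thesis
    unfolding condition_def using condition_finite[OF C] finite_insert by blast
qed

text \<open>Every pair of the larger set is a translate of a pair of \<open>C\<close> by an element
  of \<Sigma>. If \<open>p\<close> and \<open>q\<close> are the translating elements, the
  requirement for \<open>s\<close> becomes the one for
  \<open>inv q \<otimes> (s \<otimes> p)\<close> in \<open>C\<close>.\<close>

lemma condition_insert_sim:
  assumes C: "condition C" and xy: "(x, y) \<in> C" and r: "r \<in> \<Sigma>"
  shows "condition (insert (a r x, a r y) C)"
proof -
  have iff: "x' = a s u \<longleftrightarrow> y' = a s v" if "(u, v) \<in> C" "(x', y') \<in> C" "s \<in> \<Sigma>" for u v x' y' s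
    using C that by (auto simp: condition_def)
  have r': "r \<in> carrier \<Gamma>" using \<Sigma>_carrier[OF r] .
  have "x' = a s u \<longleftrightarrow> y' = a s v"
    if *: "(u, v) \<in> insert (a r x, a r y) C" "(x', y') \<in> insert (a r x, a r y) C" and s: "s \<in> \<Sigma>"
    for u v x' y' s
  proof -
    have s': "s \<in> carrier \<Gamma>" using \<Sigma>_carrier[OF s] .
    obtain u0 v0 p where p: "(u0, v0) \<in> C" "p \<in> \<Sigma>" "u = a p u0" "v = a p v0"
      using *(1) xy r subgroup.one_closed[OF subgroup_\<Sigma>] a_one by (metis insert_iff Pair_inject)
    obtain x0 y0 q where q: "(x0, y0) \<in> C" "q \<in> \<Sigma>" "x' = a q x0" "y' = a q y0"
      using *(2) xy r subgroup.one_closed[OF subgroup_\<Sigma>] a_one by (metis insert_iff Pair_inject)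
    have c: "p \<in> carrier \<Gamma>" "q \<in> carrier \<Gamma>" using p q \<Sigma>_carrier by auto
    have "inv q \<otimes> (s \<otimes> p) \<in> \<Sigma>"
      using p(2) q(2) s by (simp add: subgroup.m_closed[OF subgroup_\<Sigma>] subgroup.m_inv_closed[OF subgroup_\<Sigma>])
    from iff[OF p(1) q(1) this] show ?thesis
      using c s' p q by (simp add: a_eq_iff a_mult)
  qed
  then show ?thesis
    unfolding condition_def using condition_finite[OF C] finite_insert by blast
qed

definition equivariant :: "('x \<Rightarrow> 'x) \<Rightarrow> bool" where
  "equivariant \<sigma> \<longleftrightarrow> bij \<sigma> \<and> (\<forall>s\<in>\<Sigma>. \<forall>x. \<sigma> (a s x) = a s (\<sigma> x))"

definition extends :: "('x \<Rightarrow> 'x) \<Rightarrow> ('x \<times> 'x) set \<Rightarrow> bool" where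
  "extends \<sigma> C \<longleftrightarrow> (\<forall>x y. (x, y) \<in> C \<longrightarrow> \<sigma> x = y)"

text \<open>If \<open>x\<close> lies in the \<Sigma>-orbit of a domain point, equivariance forces
  its value; otherwise any point in a \<Gamma>-orbit away from the range may be chosen.\<close>

lemma condition_total:
  assumes C: "condition C"
  shows "\<exists>C'. C \<subseteq> C' \<and> condition C' \<and> x \<in> Domain C'"
proof (cases "\<exists>u\<in>Domain C. sim u x")
  case True
  then obtain u v s where "(u, v) \<in> C" "s \<in> \<Sigma>" "x = a s u" unfolding sim_def by blast
  then have "condition (insert (x, a s v) C)" using condition_insert_sim[OF C] by simp
  then show ?thesis by blast
next
  case False
  have "finite (Range C)" using condition_finite[OF C] by (rule finite_Range)
  then obtain z where z: "\<forall>y\<in>Range C. \<forall>g\<in>carrier \<Gamma>. a g y \<noteq> z" using a_fresh by blast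
  then have "\<not> sim v z" if "v \<in> Range C" for v
    using that \<Sigma>_carrier unfolding sim_def by blast
  then have "condition (insert (x, z) C)"
    using False by (intro condition_insert[OF C]) blast+
  then show ?thesis by blast
qed

text \<open>The symmetry of the definition in the two coordinates reduces extending the range to
  extending the domain.\<close>

lemma condition_converse: "condition (C\<inverse>) \<longleftrightarrow> condition C"
  unfolding condition_def finite_converse converse_iff by blast

lemma condition_surj:
  assumes C: "condition C"
  shows "\<exists>C'. C \<subseteq> C' \<and> condition C' \<and> x \<in> Range C'"
proof -
  obtain C' where "C\<inverse> \<subseteq> C'" "condition C'" "x \<in> Domain C'"
    using condition_total[of "C\<inverse>" x] C condition_converse by blast
  then show ?thesis using condition_converse[of C'] by (intro exI[of _ "C'\<inverse>"]) auto
qed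

text \<open>A Baire category (Rasiowa-Sikorski) argument: an increasing chain of conditions passes
  through each of countably many dense sets, and its union is the graph of
  \<open>\<sigma>\<close>.\<close>

lemma generic_equivariant:
  assumes "countable \<D>"
    and dense: "\<forall>D\<in>\<D>. \<forall>C. condition C \<longrightarrow> (\<exists>C'\<in>D. C \<subseteq> C' \<and> condition C')"
  shows "\<exists>\<sigma>. equivariant \<sigma> \<and> (\<forall>D\<in>\<D>. \<exists>C\<in>D. extends \<sigma> C)"
proof -
  \<comment> \<open>The added sets are dense by \<open>condition_total\<close> and
    \<open>condition_surj\<close>; meeting them makes the limit total and surjective.\<close>
  define \<D>' where "\<D>' = \<D> \<union> range (\<lambda>x. {C. x \<in> Domain C}) \<union> range (\<lambda>x. {C. x \<in> Range C})"
  have D': "countable \<D>'" "\<D>' \<noteq> {}" using assms(1) by (auto simp: \<D>'_def)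
  have dense': "\<exists>C'\<in>D. C \<subseteq> C' \<and> condition C'" if "D \<in> \<D>'" "condition C" for D C
  proof -
    consider "D \<in> \<D>" | x where "D = {C. x \<in> Domain C}" | x where "D = {C. x \<in> Range C}"
      using \<open>D \<in> \<D>'\<close> unfolding \<D>'_def by blast
    then show ?thesis
    proof cases
      case 1
      then show ?thesis using dense that(2) by blast
    next
      case (2 x)
      then show ?thesis using condition_total[OF that(2), of x] by auto
    next
      case (3 x)
      then show ?thesis using condition_surj[OF that(2), of x] by auto
    qed
  qed
  \<comment> \<open>At stage \<open>n\<close> the chain enters the set with index \<open>n\<close>
    in an enumeration of \<open>\<D>'\<close>.\<close>
  have "\<exists>f. \<forall>n. condition (f n) \<and> (f n \<subseteq> f (Suc n) \<and> f (Suc n) \<in> from_nat_into \<D>' n)"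
  proof (rule dependent_nat_choice)
    show "\<exists>C. condition C" by (rule exI[of _ "{}"]) (simp add: condition_def)
    show "\<exists>C'. condition C' \<and> (C \<subseteq> C' \<and> C' \<in> from_nat_into \<D>' n)" if "condition C" for C n
      using dense'[OF from_nat_into[OF D'(2)] that] by blast
  qed
  then obtain f where f: "\<And>n. condition (f n)" "\<And>n. f n \<subseteq> f (Suc n)"
      "\<And>n. f (Suc n) \<in> from_nat_into \<D>' n" by blast
  have mono: "f m \<subseteq> f n" if "m \<le> n" for m n
    using lift_Suc_mono_le[of f, OF f(2) that] .
  define U where "U = (\<Union>n. f n)"
  have U: "x' = a s x \<longleftrightarrow> y' = a s y" if U: "(x, y) \<in> U" "(x', y') \<in> U" and "s \<in> \<Sigma>" for x y x' y' s
  proof -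
    obtain m n where "(x, y) \<in> f m" "(x', y') \<in> f n" using U by (auto simp: U_def)
    then have "(x, y) \<in> f (max m n)" "(x', y') \<in> f (max m n)"
      using mono[of m "max m n"] mono[of n "max m n"] by auto
    then show ?thesis using f(1)[of "max m n"] \<open>s \<in> \<Sigma>\<close> unfolding condition_def by blast
  qed
  have met: "\<exists>C\<in>D. C \<subseteq> U" if "D \<in> \<D>'" for D
    using f(3)[of "to_nat_on \<D>' D"] that D'(1) by (auto simp: U_def)
  have "\<exists>y. (x, y) \<in> U" "\<exists>y. (y, x) \<in> U" for x
    using met[of "{C. x \<in> Domain C}"] met[of "{C. x \<in> Range C}"] by (auto simp: \<D>'_def)
  \<comment> \<open>Compatibility for \<open>s = \<one>\<close> says that the limit is single-valued
    and injective.\<close>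
  moreover have "x = x' \<longleftrightarrow> y = y'" if "(x, y) \<in> U" "(x', y') \<in> U" for x y x' y'
    using U[OF that subgroup.one_closed[OF subgroup_\<Sigma>]] by (auto simp: a_one)
  ultimately obtain \<sigma> where \<sigma>: "\<And>x y. (x, y) \<in> U \<longleftrightarrow> \<sigma> x = y" "bij \<sigma>"
    by (metis (no_types, opaque_lifting) bij_iff)
  have "equivariant \<sigma>"
    using \<sigma> U[of x "\<sigma> x" "a s x" "\<sigma> (a s x)" s for x s] by (auto simp: equivariant_def)
  moreover have "\<exists>C\<in>D. extends \<sigma> C" if "D \<in> \<D>" for D
    using met[of D] that \<sigma>(1) by (auto simp: \<D>'_def extends_def)
  ultimately show ?thesis by blast
qed

text \<open>For each pair in \<open>L\<close> a new point \<open>z\<close> is taken, and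
  \<open>(z, u)\<close> and \<open>(a k z, v)\<close> are inserted. The hypotheses on
  \<open>L\<close> keep all targets in distinct \<Sigma>-orbits off the range of \<open>C\<close>;
  \<open>z\<close> and \<open>a k z\<close> lie in distinct \<Sigma>-orbits because \<open>k\<close>
  is outside \<Sigma>.\<close>

lemma condition_connect:
  assumes C: "condition C" and "finite L" and k: "k \<in> carrier \<Gamma>" "k \<notin> \<Sigma>"
    and L: "\<forall>u v w. (u, v) \<in> L \<and> w \<in> Range C \<longrightarrow> \<not> sim w u \<and> \<not> sim w v"
      "\<forall>u v u' v'. (u, v) \<in> L \<and> (u', v') \<in> L \<longrightarrow> \<not> sim u v'"
      "\<forall>u v u' v'. (u, v) \<in> L \<and> (u', v') \<in> L \<and> (u, v) \<noteq> (u', v') \<longrightarrow> \<not> sim u u' \<and> \<not> sim v v'"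
  shows "\<exists>C'. C \<subseteq> C' \<and> condition C' \<and> (\<forall>u v. (u, v) \<in> L \<longrightarrow> (\<exists>z. (z, u) \<in> C' \<and> (a k z, v) \<in> C'))"
proof -
  have L': "\<lbrakk>(u, v) \<in> L; w \<in> Range C\<rbrakk> \<Longrightarrow> \<not> sim w u \<and> \<not> sim w v"
    "\<lbrakk>(u, v) \<in> L; (u', v') \<in> L\<rbrakk> \<Longrightarrow> \<not> sim u v'"
    "\<lbrakk>(u, v) \<in> L; (u', v') \<in> L; (u, v) \<noteq> (u', v')\<rbrakk> \<Longrightarrow> \<not> sim u u' \<and> \<not> sim v v'" for u v w u' v'
    using L by simp_all
  \<comment> \<open>The exact range is part of the induction, so that the next targets can be
    compared with all earlier ones.\<close>
  have "\<exists>C'. C \<subseteq> C' \<and> condition C' \<and> Range C' = Range C \<union> fst ` M \<union> snd ` M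
      \<and> (\<forall>u v. (u, v) \<in> M \<longrightarrow> (\<exists>z. (z, u) \<in> C' \<and> (a k z, v) \<in> C'))" if "finite M" "M \<subseteq> L" for M
    using that
  proof (induction M)
    case empty
    then show ?case using C by auto
  next
    case (insert p M)
    obtain u v where p: "p = (u, v)" by force
    obtain C' where C': "C \<subseteq> C'" "condition C'" "Range C' = Range C \<union> fst ` M \<union> snd ` M"
      "\<And>u v. (u, v) \<in> M \<Longrightarrow> \<exists>z. (z, u) \<in> C' \<and> (a k z, v) \<in> C'"
      using insert by auto
    have "finite (Domain C')" using condition_finite[OF C'(2)] by (rule finite_Domain)
    then obtain z where z: "\<forall>y\<in>Domain C'. \<forall>g\<in>carrier \<Gamma>. a g y \<noteq> z" using a_fresh by blast
    have uv: "(u, v) \<in> L" "(u, v) \<notin> M" "M \<subseteq> L" using insert p by auto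
    have nu: "\<not> sim w u" "\<not> sim w v" if "w \<in> Range C'" for w
    proof -
      consider "w \<in> Range C" | v' where "(w, v') \<in> M" | u' where "(u', w) \<in> M"
        using \<open>w \<in> Range C'\<close> C'(3) by auto
      then have "\<not> sim w u \<and> \<not> sim w v"
      proof cases
        case 1
        then show ?thesis using L'(1) uv(1) by blast
      next
        case 2
        then have "(w, v') \<in> L" "(w, v') \<noteq> (u, v)" using uv by auto
        then show ?thesis using L'(2,3) uv(1) by blast
      next
        case 3
        then have "(u', w) \<in> L" "(u', w) \<noteq> (u, v)" using uv by auto
        then show ?thesis using L'(2)[of u v u' w] L'(3)[of u' w u v] uv(1) sim_sym by blast
      qed
      then show "\<not> sim w u" "\<not> sim w v" by auto
    qed
    have nz: "\<not> sim w z" if "w \<in> Domain C'" for w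
      using z that \<Sigma>_carrier unfolding sim_def by blast
    have c1: "condition (insert (z, u) C')"
      using nu nz by (intro condition_insert[OF C'(2)]) auto
    \<comment> \<open>For \<open>w = z\<close> freeness would give \<open>k = s\<close> in \<Sigma>;
      for an older \<open>w\<close>, the new point \<open>z\<close> would lie in its
      \<Gamma>-orbit.\<close>
    have "\<not> sim w (a k z)" if "w \<in> Domain (insert (z, u) C')" for w
    proof
      assume "sim w (a k z)"
      then obtain s where s: "s \<in> \<Sigma>" "a k z = a s w" by (auto simp: sim_def)
      show False
      proof (cases "w = z")
        case True
        then show False using a_inject[of k s z] s k \<Sigma>_carrier by auto
      next
        case False
        then have "w \<in> Domain C'" using that by auto
        moreover have "z = a (inv k \<otimes> s) w" using s k \<Sigma>_carrier a_eq_iff[of k z] by (simp add: a_mult)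
        ultimately show False using z s k \<Sigma>_carrier by auto
      qed
    qed
    moreover have "\<not> sim w v" if "w \<in> Range (insert (z, u) C')" for w
      using that nu L'(2) uv(1) by auto
    ultimately have "condition (insert (a k z, v) (insert (z, u) C'))"
      by (intro condition_insert[OF c1]) auto
    moreover have "\<exists>z'. (z', u') \<in> insert (a k z, v) (insert (z, u) C')
        \<and> (a k z', v') \<in> insert (a k z, v) (insert (z, u) C')" if "(u', v') \<in> insert p M" for u' v'
      using that C'(4)[of u' v'] p by blast
    moreover have "Range (insert (a k z, v) (insert (z, u) C')) = Range C \<union> fst ` insert p M \<union> snd ` insert p M"
      using C'(3) p by auto
    ultimately show ?case using C'(1) by (meson subset_insertI2)
  qed
  from this[OF \<open>finite L\<close> subset_refl] show ?thesis by (elim exE conjE) auto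
qed

end

section \<open>Twisting a free action along an edge orbit\<close>

locale twisted_tree_action = free_action_subgroup \<Gamma> a "stabilizer \<Gamma> \<beta> e0"
  for \<Gamma> :: "'g monoid" (structure) and a :: "'g \<Rightarrow> 'x::countable \<Rightarrow> 'x" and \<beta> :: "'g \<Rightarrow> 'e \<Rightarrow> 'e" and e0 +
  fixes X :: "('v, 'e) sgraph" and \<alpha>
  assumes tree: "gtree X" and acts: "acts_on_graph \<Gamma> X \<alpha> \<beta>" and e0: "e0 \<in> edges X"
    and no_inversion: "g \<in> carrier \<Gamma> \<Longrightarrow> \<beta> g e0 \<noteq> einv X e0"
begin

lemma graph: "serre_graph X"
  using tree by (simp add: gtree_def)

lemmas graphD = serre_graphD[OF graph]

sublocale V: group_action \<Gamma> "verts X" \<alpha>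
  using acts by (simp add: acts_on_graph_def)

sublocale E: group_action \<Gamma> "edges X" \<beta>
  using acts by (simp add: acts_on_graph_def)

lemma \<alpha>_one: "v \<in> verts X \<Longrightarrow> \<alpha> \<one> v = v"
  using V.id_eq_one by (metis restrict_apply')

lemma \<beta>_one: "e \<in> edges X \<Longrightarrow> \<beta> \<one> e = e"
  using E.id_eq_one by (metis restrict_apply')

lemma \<beta>_edges: "\<lbrakk>g \<in> carrier \<Gamma>; e \<in> edges X\<rbrakk> \<Longrightarrow> \<beta> g e \<in> edges X"
  using E.element_image by blast

lemma \<beta>_graph:
  assumes "g \<in> carrier \<Gamma>" "e \<in> edges X"
  shows "src X (\<beta> g e) = \<alpha> g (src X e)" "rng X (\<beta> g e) = \<alpha> g (rng X e)"
    "einv X (\<beta> g e) = \<beta> g (einv X e)"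
  using acts assms by (auto simp: acts_on_graph_def)

lemma gpath_translate:
  assumes "gpath X u es v" "g \<in> carrier \<Gamma>"
  shows "gpath X (\<alpha> g u) (map (\<beta> g) es) (\<alpha> g v)"
  using assms(1)
  by (induction es arbitrary: u) (use assms(2) V.element_image \<beta>_edges \<beta>_graph in auto)

text \<open>An overlap of the two orbits, moved back by \<open>inv h\<close>, would be an inversion
  of \<open>e0\<close>. Hence the two non-trivial branches of \<open>edge_perm\<close> are
  exclusive.\<close>

lemma orbit_no_inversion:
  assumes "g \<in> carrier \<Gamma>" "h \<in> carrier \<Gamma>"
  shows "\<beta> g e0 \<noteq> einv X (\<beta> h e0)"
proof
  assume *: "\<beta> g e0 = einv X (\<beta> h e0)"
  have "\<beta> (inv h \<otimes> g) e0 = \<beta> (inv h) (\<beta> h (einv X e0))"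
    using * assms e0 by (simp add: E.composition_rule \<beta>_graph)
  also have "\<dots> = einv X e0"
    using assms e0 graphD(3) by (simp add: E.composition_rule[symmetric] \<beta>_one)
  finally show False using no_inversion[of "inv h \<otimes> g"] assms by simp
qed

lemma same_edge:
  assumes "g \<in> carrier \<Gamma>" "h \<in> carrier \<Gamma>"
  shows "\<beta> g e0 = \<beta> h e0 \<longleftrightarrow> inv h \<otimes> g \<in> stabilizer \<Gamma> \<beta> e0"
proof
  assume "\<beta> g e0 = \<beta> h e0"
  then have "\<beta> (inv h \<otimes> g) e0 = \<beta> (inv h \<otimes> h) e0"
    using assms e0 E.composition_rule by (metis inv_closed)
  then show "inv h \<otimes> g \<in> stabilizer \<Gamma> \<beta> e0"
    using assms e0 \<beta>_one by (simp add: stabilizer_def)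
next
  assume "inv h \<otimes> g \<in> stabilizer \<Gamma> \<beta> e0"
  then have "\<beta> h (\<beta> (inv h \<otimes> g) e0) = \<beta> h e0" by (simp add: stabilizer_def)
  then show "\<beta> g e0 = \<beta> h e0"
    using assms e0 by (simp add: E.composition_rule[symmetric] m_assoc[symmetric])
qed

section \<open>Permutations attached to the edges\<close>

lemma equivariant_inv:
  assumes "equivariant \<sigma>"
  shows "equivariant (inv_into UNIV \<sigma>)"
proof -
  have "bij \<sigma>" using assms by (simp add: equivariant_def)
  moreover have "inv_into UNIV \<sigma> (a s x) = a s (inv_into UNIV \<sigma> x)" if "s \<in> stabilizer \<Gamma> \<beta> e0" for s x
    using assms that \<open>bij \<sigma>\<close> by (metis equivariant_def bij_inv_eq_iff)
  ultimately show ?thesis by (simp add: equivariant_def bij_imp_bij_inv)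
qed

text \<open>\<open>g\<close> and \<open>h\<close> differ by an element of the stabilizer of
  \<open>e0\<close>, with whose action \<open>\<sigma>\<close> commutes.\<close>

lemma conjugate_well_defined:
  assumes "equivariant \<sigma>" "g \<in> carrier \<Gamma>" "h \<in> carrier \<Gamma>" "\<beta> g e0 = \<beta> h e0"
  shows "a g \<circ> \<sigma> \<circ> a (inv g) = a h \<circ> \<sigma> \<circ> a (inv h)"
proof
  fix x
  define s where "s = inv h \<otimes> g"
  have s: "s \<in> stabilizer \<Gamma> \<beta> e0" "s \<in> carrier \<Gamma>"
    using assms same_edge by (auto simp: s_def)
  have g: "a g y = a h (a s y)" for y
    using assms by (simp add: s_def a_mult a_inv)
  have "a g (\<sigma> (a (inv g) x)) = a h (\<sigma> (a s (a (inv g) x)))"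
    using g assms(1) s(1) by (simp add: equivariant_def)
  also have "a s (a (inv g) x) = a (inv h) x"
    using assms(2,3) by (simp add: s_def a_mult a_inv)
  finally show "(a g \<circ> \<sigma> \<circ> a (inv g)) x = (a h \<circ> \<sigma> \<circ> a (inv h)) x" by simp
qed

text \<open>The element chosen by \<open>SOME\<close> is immaterial by
  \<open>conjugate_well_defined\<close>.\<close>

definition edge_perm :: "('x \<Rightarrow> 'x) \<Rightarrow> 'e \<Rightarrow> 'x \<Rightarrow> 'x" where
  "edge_perm \<sigma> e =
    (if \<exists>g\<in>carrier \<Gamma>. e = \<beta> g e0
     then let g = (SOME g. g \<in> carrier \<Gamma> \<and> e = \<beta> g e0) in a g \<circ> \<sigma> \<circ> a (inv g)
     else if \<exists>g\<in>carrier \<Gamma>. e = einv X (\<beta> g e0)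
     then let g = (SOME g. g \<in> carrier \<Gamma> \<and> e = einv X (\<beta> g e0)) in a g \<circ> inv_into UNIV \<sigma> \<circ> a (inv g)
     else id)"

lemma edge_perm_pos:
  assumes "equivariant \<sigma>" "g \<in> carrier \<Gamma>"
  shows "edge_perm \<sigma> (\<beta> g e0) = a g \<circ> \<sigma> \<circ> a (inv g)"
proof -
  define h where "h = (SOME h. h \<in> carrier \<Gamma> \<and> \<beta> g e0 = \<beta> h e0)"
  have h: "h \<in> carrier \<Gamma> \<and> \<beta> g e0 = \<beta> h e0"
    unfolding h_def by (rule someI[of _ g]) (use assms in simp)
  have "edge_perm \<sigma> (\<beta> g e0) = a h \<circ> \<sigma> \<circ> a (inv h)"
    using assms unfolding edge_perm_def Let_def h_def by auto
  then show ?thesis using conjugate_well_defined[OF assms, of h] h by metis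
qed

lemma edge_perm_neg:
  assumes "equivariant \<sigma>" "g \<in> carrier \<Gamma>"
  shows "edge_perm \<sigma> (einv X (\<beta> g e0)) = a g \<circ> inv_into UNIV \<sigma> \<circ> a (inv g)"
proof -
  define h where "h = (SOME h. h \<in> carrier \<Gamma> \<and> einv X (\<beta> g e0) = einv X (\<beta> h e0))"
  have h: "h \<in> carrier \<Gamma> \<and> einv X (\<beta> g e0) = einv X (\<beta> h e0)"
    unfolding h_def by (rule someI[of _ g]) (use assms in simp)
  then have "\<beta> g e0 = \<beta> h e0" using assms e0 graphD(5) \<beta>_edges by metis
  moreover have "\<not> (\<exists>h\<in>carrier \<Gamma>. einv X (\<beta> g e0) = \<beta> h e0)"
    using orbit_no_inversion assms by metis
  then have "edge_perm \<sigma> (einv X (\<beta> g e0)) = a h \<circ> inv_into UNIV \<sigma> \<circ> a (inv h)"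
    using assms unfolding edge_perm_def Let_def h_def by auto
  ultimately show ?thesis
    using conjugate_well_defined[OF equivariant_inv[OF assms(1)] assms(2), of h] h by metis
qed

lemma edge_cases:
  obtains (pos) g where "g \<in> carrier \<Gamma>" "e = \<beta> g e0"
  | (neg) g where "g \<in> carrier \<Gamma>" "e = einv X (\<beta> g e0)"
  | (other) "\<And>g. g \<in> carrier \<Gamma> \<Longrightarrow> e \<noteq> \<beta> g e0" "\<And>g. g \<in> carrier \<Gamma> \<Longrightarrow> e \<noteq> einv X (\<beta> g e0)"
  by blast

lemma edge_perm_other:
  assumes "\<And>g. g \<in> carrier \<Gamma> \<Longrightarrow> e \<noteq> \<beta> g e0" "\<And>g. g \<in> carrier \<Gamma> \<Longrightarrow> e \<noteq> einv X (\<beta> g e0)"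
  shows "edge_perm \<sigma> e = id"
  using assms by (auto simp: edge_perm_def)

text \<open>Supplies the hypothesis of \<open>path_map_unique\<close>: the two edges carry
  conjugates of \<open>\<sigma>\<close> and of its inverse by the same group element, or both carry
  the identity.\<close>

lemma edge_perm_einv:
  assumes \<sigma>: "equivariant \<sigma>" and e: "e \<in> edges X"
  shows "edge_perm \<sigma> e \<circ> edge_perm \<sigma> (einv X e) = id"
proof -
  have b: "\<sigma> (inv_into UNIV \<sigma> x) = x" "inv_into UNIV \<sigma> (\<sigma> x) = x" for x
    using \<sigma> by (auto simp: equivariant_def bij_is_surj surj_f_inv_f bij_is_inj)
  show ?thesis
  proof (cases e rule: edge_cases)
    case (pos g)
    then show ?thesis using b edge_perm_pos[OF \<sigma>] edge_perm_neg[OF \<sigma>] by (auto simp: fun_eq_iff a_inv)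
  next
    case (neg g)
    moreover have "einv X e = \<beta> g e0" using neg graphD(5) e0 \<beta>_edges by metis
    ultimately show ?thesis
      using b edge_perm_pos[OF \<sigma>] edge_perm_neg[OF \<sigma>] by (auto simp: fun_eq_iff a_inv)
  next
    case other
    have "einv X e \<noteq> \<beta> g e0" "einv X e \<noteq> einv X (\<beta> g e0)" if "g \<in> carrier \<Gamma>" for g
      using other that e e0 \<beta>_edges graphD(5) by metis+
    then show ?thesis using other by (simp add: edge_perm_other)
  qed
qed

text \<open>The edge \<open>\<beta> g (\<beta> h e0)\<close> carries the conjugate by
  \<open>g \<otimes> h\<close>; thus the family is \<Gamma>-equivariant although
  \<open>\<sigma>\<close> is only required to commute with \<Sigma>.\<close>

lemma edge_perm_translate:
  assumes \<sigma>: "equivariant \<sigma>" and e: "e \<in> edges X" and g: "g \<in> carrier \<Gamma>"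
  shows "edge_perm \<sigma> (\<beta> g e) = a g \<circ> edge_perm \<sigma> e \<circ> a (inv g)"
proof (cases e rule: edge_cases)
  case (pos h)
  then have "\<beta> g e = \<beta> (g \<otimes> h) e0" using g e0 by (simp add: E.composition_rule)
  then show ?thesis
    using pos g edge_perm_pos[OF \<sigma>] by (auto simp: fun_eq_iff a_mult inv_mult_group)
next
  case (neg h)
  then have "\<beta> g e = einv X (\<beta> (g \<otimes> h) e0)"
    using g e0 \<beta>_edges by (simp add: E.composition_rule \<beta>_graph)
  then show ?thesis
    using neg g edge_perm_neg[OF \<sigma>] by (auto simp: fun_eq_iff a_mult inv_mult_group)
next
  case other
  have e': "e = \<beta> (inv g) (\<beta> g e)"
    using g e by (simp add: E.composition_rule[symmetric] \<beta>_one)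
  have "\<beta> g e \<noteq> \<beta> h e0" if "h \<in> carrier \<Gamma>" for h
    using other(1)[of "inv g \<otimes> h"] e' that g e0 by (simp add: E.composition_rule) metis
  moreover have "\<beta> g e \<noteq> einv X (\<beta> h e0)" if "h \<in> carrier \<Gamma>" for h
    using other(2)[of "inv g \<otimes> h"] e' that g e0 \<beta>_edges by (simp add: E.composition_rule \<beta>_graph) metis
  ultimately show ?thesis
    using other g by (auto simp: fun_eq_iff edge_perm_other a_inv)
qed

lemma path_map_translate:
  assumes \<sigma>: "equivariant \<sigma>" and g: "g \<in> carrier \<Gamma>" and "set es \<subseteq> edges X"
  shows "path_map (edge_perm \<sigma>) (map (\<beta> g) es) = a g \<circ> path_map (edge_perm \<sigma>) es \<circ> a (inv g)"
  using assms(3)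
proof (induction es)
  case Nil
  then show ?case using g by (auto simp: fun_eq_iff a_inv)
next
  case (Cons e es)
  then show ?case using edge_perm_translate[OF \<sigma> _ g] g by (auto simp: fun_eq_iff a_inv)
qed

section \<open>The twisted action\<close>

definition twist :: "('x \<Rightarrow> 'x) \<Rightarrow> 'g \<Rightarrow> 'x \<Rightarrow> 'x" where
  "twist \<sigma> g = path_map (edge_perm \<sigma>) (SOME es. gpath X (src X e0) es (\<alpha> g (src X e0))) \<circ> a g"

lemma src_translate: "g \<in> carrier \<Gamma> \<Longrightarrow> \<alpha> g (src X e0) \<in> verts X"
  using V.element_image graphD(1)[OF e0] by blast

lemma ex_path: "g \<in> carrier \<Gamma> \<Longrightarrow> \<exists>es. gpath X (src X e0) es (\<alpha> g (src X e0))"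
  using tree graphD(1)[OF e0] src_translate by (auto simp: gtree_def gconnected_def)

text \<open>Path products depend only on the end points, so the path chosen by \<open>SOME\<close>
  is immaterial.\<close>

lemma twist_eq:
  assumes \<sigma>: "equivariant \<sigma>" and es: "gpath X (src X e0) es (\<alpha> g (src X e0))"
  shows "twist \<sigma> g = path_map (edge_perm \<sigma>) es \<circ> a g"
  unfolding twist_def
  using path_map_unique[where S = "edge_perm \<sigma>", OF tree edge_perm_einv[OF \<sigma>] _ es]
    someI[of "\<lambda>es. gpath X (src X e0) es (\<alpha> g (src X e0))", OF es] by simp

text \<open>A path from the source \<open>p\<close> to \<open>g p\<close>, followed by the
  \<open>g\<close>-translate of a path from \<open>p\<close> to \<open>h p\<close>, leads to the
  image of \<open>p\<close> under \<open>g \<otimes> h\<close>. Translating a path conjugates its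
  product by \<open>a g\<close>, which accounts for the factor \<open>a g\<close> between the two
  products.\<close>

lemma twist_mult:
  assumes \<sigma>: "equivariant \<sigma>" and g: "g \<in> carrier \<Gamma>" and h: "h \<in> carrier \<Gamma>"
  shows "twist \<sigma> (g \<otimes> h) = twist \<sigma> g \<circ> twist \<sigma> h"
proof -
  obtain es fs where es: "gpath X (src X e0) es (\<alpha> g (src X e0))"
    and fs: "gpath X (src X e0) fs (\<alpha> h (src X e0))"
    using ex_path g h by blast
  have "gpath X (src X e0) (es @ map (\<beta> g) fs) (\<alpha> (g \<otimes> h) (src X e0))"
    using es gpath_translate[OF fs g] g h graphD(1)[OF e0]
    by (auto simp: gpath_append[OF graph] V.composition_rule)
  then have "twist \<sigma> (g \<otimes> h) = path_map (edge_perm \<sigma>) (es @ map (\<beta> g) fs) \<circ> a (g \<otimes> h)"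
    by (rule twist_eq[OF \<sigma>])
  also have "\<dots> = (path_map (edge_perm \<sigma>) es \<circ> a g) \<circ> (path_map (edge_perm \<sigma>) fs \<circ> a h)"
    using path_map_translate[OF \<sigma> g gpath_edges[OF fs]] g h
    by (auto simp: fun_eq_iff path_map_append a_mult a_inv)
  also have "\<dots> = twist \<sigma> g \<circ> twist \<sigma> h"
    using twist_eq[OF \<sigma> es] twist_eq[OF \<sigma> fs] by simp
  finally show ?thesis .
qed

lemma twist_one:
  assumes "equivariant \<sigma>"
  shows "twist \<sigma> \<one> = id"
  using twist_eq[OF assms, of "[]" \<one>] graphD(1)[OF e0] by (auto simp: \<alpha>_one a_one fun_eq_iff)

lemma twist_source:
  assumes "equivariant \<sigma>" "h \<in> stabilizer \<Gamma> \<alpha> (src X e0)"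
  shows "twist \<sigma> h = a h"
  using twist_eq[OF assms(1), of "[]" h] assms(2) graphD(1)[OF e0] by (auto simp: stabilizer_def)

lemma twist_range:
  assumes \<sigma>: "equivariant \<sigma>" and k: "k \<in> stabilizer \<Gamma> \<alpha> (rng X e0)"
  shows "twist \<sigma> k = \<sigma> \<circ> a k \<circ> inv_into UNIV \<sigma>"
proof -
  have k': "k \<in> carrier \<Gamma>" "\<alpha> k (rng X e0) = rng X e0" using k by (auto simp: stabilizer_def)
  \<comment> \<open>\<open>e0\<close> leads to its range, which \<open>k\<close> fixes, and the
    inverse of \<open>\<beta> k e0\<close> leads from there to the translated source. The second
    factor is the conjugate of the inverse of \<open>\<sigma>\<close> by \<open>a k\<close>, so one
    \<open>a (inv k)\<close> cancels against the final \<open>a k\<close>.\<close>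
  have path: "gpath X (src X e0) [e0, einv X (\<beta> k e0)] (\<alpha> k (src X e0))"
    using k' e0 \<beta>_edges graphD \<beta>_graph src_translate by simp
  have "edge_perm \<sigma> e0 = \<sigma>"
    using edge_perm_pos[OF \<sigma> one_closed] e0 by (auto simp: \<beta>_one a_one fun_eq_iff)
  then show ?thesis
    using twist_eq[OF \<sigma> path] edge_perm_neg[OF \<sigma> k'(1)] k'(1) by (auto simp: fun_eq_iff a_inv)
qed

text \<open>
  As the path never traverses an edge backwards, the value of \<open>\<sigma>\<close> or \<open>\<sigma>\<inverse>\<close> needed at the next
  edge is always undecided and can be chosen in a new orbit; the last two conjuncts are this
  invariant.
\<close>
lemma trace_path:
  assumes C: "condition C" and x: "\<forall>y\<in>Field C. \<forall>g\<in>carrier \<Gamma>. a g y \<noteq> x"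
    and "set es \<subseteq> edges X" "\<forall>A e B. es = A @ e # B \<longrightarrow> einv X e \<notin> set B"
  shows "\<exists>C' y. C \<subseteq> C' \<and> condition C'
      \<and> (\<forall>\<sigma>. equivariant \<sigma> \<and> extends \<sigma> C' \<longrightarrow> path_map (edge_perm \<sigma>) es x = y)
      \<and> (y = x \<or> (\<forall>g\<in>carrier \<Gamma>. a g x \<noteq> y))
      \<and> (\<forall>g\<in>carrier \<Gamma>. einv X (\<beta> g e0) \<notin> set es \<longrightarrow> (\<forall>w\<in>Domain C'. \<not> sim w (a (inv g) y)))
      \<and> (\<forall>g\<in>carrier \<Gamma>. \<beta> g e0 \<notin> set es \<longrightarrow> (\<forall>w\<in>Range C'. \<not> sim w (a (inv g) y)))"
  using assms(3,4)
proof (induction es)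
  case Nil
  have "\<not> sim w (a (inv g) x)" if "w \<in> Field C" "g \<in> carrier \<Gamma>" for w g
  proof
    assume "sim w (a (inv g) x)"
    then obtain s where "s \<in> carrier \<Gamma>" "a (inv g) x = a s w" using \<Sigma>_carrier unfolding sim_def by blast
    then have "a (g \<otimes> s) w = x" using that a_inv by (simp add: a_mult) metis
    then show False using x that \<open>s \<in> carrier \<Gamma>\<close> by simp
  qed
  then show ?case
    using C by (intro exI[of _ C] exI[of _ x]) (auto simp: Field_def)
next
  case (Cons e es)
  have "\<forall>A e B. es = A @ e # B \<longrightarrow> einv X e \<notin> set B"
    using Cons.prems(2) by (metis append_Cons)
  moreover have "set es \<subseteq> edges X" using Cons.prems(1) by simp
  ultimately obtain C' y where C': "C \<subseteq> C'" "condition C'"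
      and path': "\<forall>\<sigma>. equivariant \<sigma> \<and> extends \<sigma> C' \<longrightarrow> path_map (edge_perm \<sigma>) es x = y"
      and y: "y = x \<or> (\<forall>g\<in>carrier \<Gamma>. a g x \<noteq> y)"
      and dom': "\<forall>g\<in>carrier \<Gamma>. einv X (\<beta> g e0) \<notin> set es \<longrightarrow> (\<forall>w\<in>Domain C'. \<not> sim w (a (inv g) y))"
      and ran': "\<forall>g\<in>carrier \<Gamma>. \<beta> g e0 \<notin> set es \<longrightarrow> (\<forall>w\<in>Range C'. \<not> sim w (a (inv g) y))"
    using Cons.IH by (elim meta_impE exE conjE)
  have path: "path_map (edge_perm \<sigma>) es x = y" if "equivariant \<sigma>" "extends \<sigma> C'" for \<sigma>
    using path' that by blast
  have dom: "\<not> sim w (a (inv g) y)"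
    if "g \<in> carrier \<Gamma>" "einv X (\<beta> g e0) \<notin> set es" "w \<in> Domain C'" for g w
    using dom' that by blast
  have ran: "\<not> sim w (a (inv g) y)"
    if "g \<in> carrier \<Gamma>" "\<beta> g e0 \<notin> set es" "w \<in> Range C'" for g w
    using ran' that by blast
  \<comment> \<open>\<open>path_map\<close> applies the last permutation of the list first, so
    \<open>e\<close> comes after \<open>es\<close>; the second fact says that it does not undo an
    edge already treated.\<close>
  have e: "e \<in> edges X" "einv X e \<notin> set es" using Cons.prems(1) Cons.prems(2)[rule_format, of "[]" e es] by auto
  define N where "N = Field C' \<union> {x, y}"
  have "finite N" using condition_finite[OF C'(2)] by (simp add: N_def finite_Field)
  then obtain z where z: "\<And>w g. \<lbrakk>w \<in> N; g \<in> carrier \<Gamma>\<rbrakk> \<Longrightarrow> a g w \<noteq> z" using a_fresh by meson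
  have new: "\<not> sim (a h w) (a g z)" if "w \<in> N" "g \<in> carrier \<Gamma>" "h \<in> carrier \<Gamma>" for w g h
  proof
    assume "sim (a h w) (a g z)"
    then obtain s where s: "s \<in> carrier \<Gamma>" "a g z = a s (a h w)" using \<Sigma>_carrier unfolding sim_def by blast
    then have "z = a (inv g) (a s (a h w))" using that a_inv(1)[of g z] by simp
    then have "a (inv g \<otimes> (s \<otimes> h)) w = z" using that s(1) by (simp add: a_mult)
    then show False using z[OF that(1), of "inv g \<otimes> (s \<otimes> h)"] that s(1) by simp
  qed
  have new1: "\<not> sim w (a g z)" if "w \<in> N" "g \<in> carrier \<Gamma>" for w g
    using new[OF that one_closed] by (simp add: a_one)
  have not_orbit: "a g x \<noteq> a h z" if "g \<in> carrier \<Gamma>" "h \<in> carrier \<Gamma>" for g h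
    using new[of x h g] that sim_refl[of "a g x"] by (auto simp: N_def)
  \<comment> \<open>Only the edge just traversed loses freshness: the new point, pulled back along
    \<open>g\<close>, falls into the \<Sigma>-orbit of \<open>z\<close> only if \<open>g\<close> and
    \<open>h\<close> give the same edge.\<close>
  have same: "\<beta> g e0 = \<beta> h e0" if "sim z (a (inv g) (a h z))" "g \<in> carrier \<Gamma>" "h \<in> carrier \<Gamma>" for g h
  proof -
    obtain s where s: "s \<in> stabilizer \<Gamma> \<beta> e0" "a (inv g) (a h z) = a s z"
      using \<open>sim z _\<close> unfolding sim_def by blast
    then have "inv g \<otimes> h = s"
      using that \<Sigma>_carrier by (intro a_inject[of _ _ z]) (auto simp: a_mult)
    then show ?thesis using same_edge[of h g] that s(1) by simp
  qed
  have N: "Domain C' \<subseteq> N" "Range C' \<subseteq> N" "x \<in> N" "y \<in> N" by (auto simp: N_def Field_def)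
  show ?case
  proof (cases e rule: edge_cases)
    case (pos g)
    \<comment> \<open>The value needed next is that of \<open>\<sigma>\<close> at
      \<open>a (inv g) y\<close>, undecided by the domain invariant. It is set to the new point
      \<open>z\<close>, so the traced point moves to \<open>a g z\<close>.\<close>
    let ?C = "insert (a (inv g) y, z) C'"
    have "condition ?C"
      using dom[OF pos(1)] e(2) pos(2) N new1[OF _ one_closed]
      by (intro condition_insert[OF C'(2)]) (auto simp: a_one)
    moreover have "path_map (edge_perm \<sigma>) (e # es) x = a g z" if "equivariant \<sigma>" "extends \<sigma> ?C" for \<sigma>
      using path[OF that(1)] that edge_perm_pos[OF that(1) pos(1)] pos(2) by (auto simp: extends_def)
    moreover have "\<not> sim w (a (inv h) (a g z))" if "h \<in> carrier \<Gamma>" "w \<in> Domain ?C" for h w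
      using that new1[of w "inv h \<otimes> g"] new[of y "inv h \<otimes> g" "inv g"] N pos(1) by (auto simp: a_mult)
    moreover have "\<not> sim w (a (inv h) (a g z))"
      if "h \<in> carrier \<Gamma>" "\<beta> h e0 \<notin> set (e # es)" "w \<in> Range ?C" for h w
      using that new1[of w "inv h \<otimes> g"] same[of h g] N pos by (auto simp: a_mult)
    ultimately show ?thesis
      using C'(1) not_orbit[OF _ pos(1)] by (intro exI[of _ ?C] exI[of _ "a g z"]) blast
  next
    case (neg g)
    have einv_e: "einv X e = \<beta> g e0" using neg graphD(5) e0 \<beta>_edges by metis
    \<comment> \<open>Here the inverse of \<open>\<sigma>\<close> is needed at
      \<open>a (inv g) y\<close>, so domain and range exchange roles.\<close>
    let ?C = "insert (z, a (inv g) y) C'"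
    have "condition ?C"
      using ran[OF neg(1)] e(2) einv_e N new1[OF _ one_closed]
      by (intro condition_insert[OF C'(2)]) (auto simp: a_one)
    moreover have "path_map (edge_perm \<sigma>) (e # es) x = a g z" if "equivariant \<sigma>" "extends \<sigma> ?C" for \<sigma>
    proof -
      have "\<sigma> z = a (inv g) y" "inj \<sigma>" using that by (auto simp: extends_def equivariant_def bij_is_inj)
      then have "inv_into UNIV \<sigma> (a (inv g) y) = z" by (metis inv_f_f)
      then show ?thesis
        using path[OF that(1)] that(2) edge_perm_neg[OF that(1) neg(1)] neg(2) by (auto simp: extends_def)
    qed
    moreover have "\<not> sim w (a (inv h) (a g z))" if "h \<in> carrier \<Gamma>" "w \<in> Range ?C" for h w
      using that new1[of w "inv h \<otimes> g"] new[of y "inv h \<otimes> g" "inv g"] N neg(1) by (auto simp: a_mult)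
    moreover have "\<not> sim w (a (inv h) (a g z))"
      if "h \<in> carrier \<Gamma>" "einv X (\<beta> h e0) \<notin> set (e # es)" "w \<in> Domain ?C" for h w
      using that new1[of w "inv h \<otimes> g"] same[of h g] N neg by (auto simp: a_mult)
    ultimately show ?thesis
      using C'(1) not_orbit[OF _ neg(1)] by (intro exI[of _ ?C] exI[of _ "a g z"]) blast
  next
    case other
    have "path_map (edge_perm \<sigma>) (e # es) x = y" if "equivariant \<sigma>" "extends \<sigma> C'" for \<sigma>
      using path[OF that] edge_perm_other[OF other] by simp
    then show ?thesis
      using C' y dom ran by (intro exI[of _ C'] exI[of _ y]) auto
  qed
qed

text \<open>For \<open>x\<close> in a new \<Gamma>-orbit, \<open>trace_path\<close> gives an image
  \<open>y\<close> that equals \<open>x\<close> or leaves the orbit of \<open>x\<close>. By freeness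
  it differs either way from \<open>a (inv g) x\<close>, the point that the twisted action of
  \<open>g\<close> sends to \<open>y\<close>.\<close>

lemma faithful_dense:
  assumes C: "condition C" and g: "g \<in> carrier \<Gamma>" "g \<noteq> \<one>"
  shows "\<exists>C'. C \<subseteq> C' \<and> condition C' \<and> (\<forall>\<sigma>. equivariant \<sigma> \<and> extends \<sigma> C' \<longrightarrow> twist \<sigma> g \<noteq> id)"
proof -
  obtain es0 where "gpath X (src X e0) es0 (\<alpha> g (src X e0))" using ex_path g by blast
  from minimal_gpath[OF graph this] obtain es where
    es: "gpath X (src X e0) es (\<alpha> g (src X e0))" "\<forall>A e B. es = A @ e # B \<longrightarrow> einv X e \<notin> set B"
    by blast
  have "finite (Field C)" using condition_finite[OF C] by (rule finite_Field)
  then obtain x where x: "\<forall>w\<in>Field C. \<forall>h\<in>carrier \<Gamma>. a h w \<noteq> x" using a_fresh by blast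
  from trace_path[OF C x gpath_edges[OF es(1)] es(2)]
  obtain C' y where C': "C \<subseteq> C'" "condition C'"
      and path: "\<forall>\<sigma>. equivariant \<sigma> \<and> extends \<sigma> C' \<longrightarrow> path_map (edge_perm \<sigma>) es x = y"
      and y: "y = x \<or> (\<forall>h\<in>carrier \<Gamma>. a h x \<noteq> y)"
    by (elim exE conjE) (rule that)
  have "y \<noteq> a (inv g) x"
    using y a_free[of "inv g" x] g by (metis inv_closed inv_eq_1_iff)
  moreover have "twist \<sigma> g (a (inv g) x) = y" if "equivariant \<sigma>" "extends \<sigma> C'" for \<sigma>
    using twist_eq[OF that(1) es(1)] path that g by (simp add: a_inv)
  ultimately have "twist \<sigma> g \<noteq> id" if "equivariant \<sigma>" "extends \<sigma> C'" for \<sigma>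
    using that by (metis id_apply)
  then show ?thesis using C' by blast
qed

text \<open>By freeness a pair of points determines at most one group element. This turns finite
  sets of points into the finite sets \<open>F\<close> and \<open>K\<close> of
  \<open>separating\<close>.\<close>

lemma finite_transporter:
  assumes "finite A" "finite B"
  shows "finite {g \<in> carrier \<Gamma>. \<exists>x\<in>A. \<exists>y\<in>B. a g x = y}"
proof -
  have "{g \<in> carrier \<Gamma>. \<exists>x\<in>A. \<exists>y\<in>B. a g x = y} \<subseteq> (\<Union>x\<in>A. \<Union>y\<in>B. {g \<in> carrier \<Gamma>. a g x = y})" by blast
  moreover have "finite {g \<in> carrier \<Gamma>. a g x = y}" for x y
  proof (cases "\<exists>h\<in>carrier \<Gamma>. a h x = y")
    case True
    then obtain h where h: "h \<in> carrier \<Gamma>" "a h x = y" by blast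
    have "g = h" if "g \<in> carrier \<Gamma>" "a g x = y" for g
      using a_inject[OF that(1) h(1), of x] that(2) h(2) by simp
    then have "{g \<in> carrier \<Gamma>. a g x = y} \<subseteq> {h}" by blast
    then show ?thesis by (rule finite_subset) simp
  next
    case False
    then have "{g \<in> carrier \<Gamma>. a g x = y} = {}" by blast
    then show ?thesis by (simp only: finite.emptyI)
  qed
  ultimately show ?thesis using assms by (meson finite_UN finite_subset)
qed

end

text \<open>
  For infinite \<open>H\<close>, this is equivalent to \<open>\<Sigma>\<close> being highly core-free in \<open>H\<close>.
\<close>
definition separating :: "('g, 'b) monoid_scheme \<Rightarrow> 'g set \<Rightarrow> 'g set \<Rightarrow> bool" where
  "separating \<Gamma> \<Sigma> H \<longleftrightarrow> (\<forall>F K. finite F \<and> F \<subseteq> H \<and> finite K \<and> K \<subseteq> H \<and> \<one>\<^bsub>\<Gamma>\<^esub> \<notin> K \<longrightarrow>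
     (\<exists>h\<in>H. h \<notin> \<Sigma> <#>\<^bsub>\<Gamma>\<^esub> F \<and> (\<forall>k\<in>K. h \<otimes>\<^bsub>\<Gamma>\<^esub> k \<otimes>\<^bsub>\<Gamma>\<^esub> inv\<^bsub>\<Gamma>\<^esub> h \<notin> \<Sigma>)))"

section \<open>High transitivity by separation of points\<close>

locale separated_tree_action = twisted_tree_action \<Gamma> a \<beta> e0 X \<alpha>
  for \<Gamma> :: "'g monoid" (structure) and a :: "'g \<Rightarrow> 'x::countable \<Rightarrow> 'x" and \<beta> :: "'g \<Rightarrow> 'e \<Rightarrow> 'e"
    and e0 and X :: "('v, 'e) sgraph" and \<alpha> +
  assumes separating: "separating \<Gamma> (stabilizer \<Gamma> \<beta> e0) (stabilizer \<Gamma> \<alpha> (src X e0))"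
    and range_stabilizer: "\<not> stabilizer \<Gamma> \<alpha> (rng X e0) \<subseteq> stabilizer \<Gamma> \<beta> e0"
begin

text \<open>If \<open>a h x = a s w\<close>, then \<open>inv s \<otimes> h\<close> sends a point of
  \<open>A\<close> into \<open>B\<close> and lies in \<open>F\<close>; if
  \<open>a h x' = a s (a h x)\<close>, then \<open>inv h \<otimes> s \<otimes> h\<close> moves a
  point within \<open>A\<close> and lies in \<open>K\<close>. The choice of \<open>h\<close>
  excludes both.\<close>

lemma separate_points:
  assumes A: "finite A" and B: "finite B"
  obtains h where "h \<in> stabilizer \<Gamma> \<alpha> (src X e0)" "\<And>x w. \<lbrakk>x \<in> A; w \<in> B\<rbrakk> \<Longrightarrow> \<not> sim w (a h x)"
    "\<And>x x'. \<lbrakk>x \<in> A; x' \<in> A; x \<noteq> x'\<rbrakk> \<Longrightarrow> \<not> sim (a h x) (a h x')"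
proof -
  let ?H = "stabilizer \<Gamma> \<alpha> (src X e0)" and ?\<Sigma> = "stabilizer \<Gamma> \<beta> e0"
  define F where "F = {g \<in> carrier \<Gamma>. \<exists>x\<in>A. \<exists>y\<in>B. a g x = y} \<inter> ?H"
  define K where "K = {g \<in> carrier \<Gamma>. \<exists>x\<in>A. \<exists>y\<in>A. a g x = y} \<inter> ?H - {\<one>}"
  have "finite F" "finite K" using finite_transporter A B by (auto simp: F_def K_def)
  moreover have "F \<subseteq> ?H" "K \<subseteq> ?H" "\<one> \<notin> K" by (auto simp: F_def K_def)
  ultimately obtain h where h: "h \<in> ?H" "h \<notin> ?\<Sigma> <#> F" "\<And>k. k \<in> K \<Longrightarrow> h \<otimes> k \<otimes> inv h \<notin> ?\<Sigma>"
    using separating[unfolded separating_def, rule_format, of F K] by blast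
  have H: "subgroup ?H \<Gamma>" using V.stabilizer_subgroup graphD(1)[OF e0] by blast
  have \<Sigma>H: "?\<Sigma> \<subseteq> ?H" using \<beta>_graph(1)[OF _ e0] by (auto simp: stabilizer_def) metis
  have hc: "h \<in> carrier \<Gamma>" using h(1) by (simp add: stabilizer_def)
  show ?thesis
  proof (rule that[OF h(1)])
    fix x w assume xw: "x \<in> A" "w \<in> B"
    show "\<not> sim w (a h x)"
    proof
      assume "sim w (a h x)"
      then obtain s where s: "s \<in> ?\<Sigma>" "a h x = a s w" unfolding sim_def by blast
      have sc: "s \<in> carrier \<Gamma>" using s \<Sigma>_carrier by blast
      have "a (inv s \<otimes> h) x = w" using s sc hc by (simp add: a_mult a_inv)
      moreover have "inv s \<otimes> h \<in> ?H"
        using H s(1) \<Sigma>H h(1) by (meson subgroup.m_closed subgroup.m_inv_closed subsetD)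
      ultimately have "inv s \<otimes> h \<in> F" using xw sc hc by (auto simp: F_def)
      moreover have "h = s \<otimes> (inv s \<otimes> h)" using sc hc by (simp add: m_assoc[symmetric])
      ultimately show False using h(2) s(1) unfolding set_mult_def by blast
    qed
  next
    fix x x' assume xx: "x \<in> A" "x' \<in> A" "x \<noteq> x'"
    show "\<not> sim (a h x) (a h x')"
    proof
      assume "sim (a h x) (a h x')"
      then obtain s where s: "s \<in> ?\<Sigma>" "a h x' = a s (a h x)" unfolding sim_def by blast
      have sc: "s \<in> carrier \<Gamma>" using s \<Sigma>_carrier by blast
      define k where "k = inv h \<otimes> s \<otimes> h"
      have "a k x = a (inv h) (a h x')" using s sc hc by (simp add: k_def a_mult)
      then have k: "a k x = x'" using hc by (simp add: a_inv)
      then have "k \<noteq> \<one>" using xx(3) by (auto simp: a_one)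
      moreover have "k \<in> ?H"
        unfolding k_def using H s(1) \<Sigma>H h(1) by (meson subgroup.m_closed subgroup.m_inv_closed subsetD)
      ultimately have "k \<in> K" using k xx sc hc by (auto simp: K_def k_def)
      moreover have "h \<otimes> k \<otimes> inv h = s" using sc hc by (simp add: k_def m_assoc) (simp add: m_assoc[symmetric])
      ultimately show False using h(3) s(1) by blast
    qed
  qed
qed

lemma transitive_dense:
  assumes C: "condition C" and Q: "finite Q" "inj_on fst Q" "inj_on snd Q"
  shows "\<exists>C'. C \<subseteq> C' \<and> condition C'
    \<and> (\<exists>g\<in>carrier \<Gamma>. \<forall>\<sigma>. equivariant \<sigma> \<and> extends \<sigma> C' \<longrightarrow> (\<forall>(x, y)\<in>Q. twist \<sigma> g x = y))"
proof -
  let ?H = "stabilizer \<Gamma> \<alpha> (src X e0)"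
  have fin: "finite (Range C)" using condition_finite[OF C] by (rule finite_Range)
  obtain h where h: "h \<in> ?H" "\<And>x w. \<lbrakk>x \<in> fst ` Q; w \<in> Range C\<rbrakk> \<Longrightarrow> \<not> sim w (a h x)"
    "\<And>x x'. \<lbrakk>x \<in> fst ` Q; x' \<in> fst ` Q; x \<noteq> x'\<rbrakk> \<Longrightarrow> \<not> sim (a h x) (a h x')"
    using separate_points[of "fst ` Q" "Range C"] fin Q(1) by blast
  \<comment> \<open>The points already placed by \<open>h\<close> are among those to avoid, so that
    \<open>a h x\<close> and \<open>a h' y\<close> never share a \<Sigma>-orbit.\<close>
  obtain h' where h': "h' \<in> ?H"
    "\<And>y w. \<lbrakk>y \<in> snd ` Q; w \<in> Range C \<union> a h ` fst ` Q\<rbrakk> \<Longrightarrow> \<not> sim w (a h' y)"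
    "\<And>y y'. \<lbrakk>y \<in> snd ` Q; y' \<in> snd ` Q; y \<noteq> y'\<rbrakk> \<Longrightarrow> \<not> sim (a h' y) (a h' y')"
    using separate_points[of "snd ` Q" "Range C \<union> a h ` fst ` Q"] fin Q(1) by blast
  obtain k where k: "k \<in> stabilizer \<Gamma> \<alpha> (rng X e0)" "k \<notin> stabilizer \<Gamma> \<beta> e0"
    using range_stabilizer by blast
  have c: "h \<in> carrier \<Gamma>" "h' \<in> carrier \<Gamma>" "k \<in> carrier \<Gamma>"
    using h(1) h'(1) k(1) by (auto simp: stabilizer_def)
  define L where "L = (\<lambda>(x, y). (a h x, a h' y)) ` Q"
  have LE: "\<exists>x y. (x, y) \<in> Q \<and> u = a h x \<and> v = a h' y" if "(u, v) \<in> L" for u v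
    using that by (auto simp: L_def)
  have mem: "x \<in> fst ` Q" "y \<in> snd ` Q" if "(x, y) \<in> Q" for x y using that by force+
  have neq: "x \<noteq> x'" "y \<noteq> y'" if "(x, y) \<in> Q" "(x', y') \<in> Q" "(x, y) \<noteq> (x', y')" for x y x' y'
    using inj_onD[OF Q(2) _ that(1,2)] inj_onD[OF Q(3) _ that(1,2)] that(3) by auto
  have L1: "\<forall>u v w. (u, v) \<in> L \<and> w \<in> Range C \<longrightarrow> \<not> sim w u \<and> \<not> sim w v"
  proof (intro allI impI, elim conjE)
    fix u v w assume "(u, v) \<in> L" and w: "w \<in> Range C"
    then obtain x y where "(x, y) \<in> Q" "u = a h x" "v = a h' y" using LE by blast
    then show "\<not> sim w u \<and> \<not> sim w v" using h(2)[of x w] h'(2)[of y w] mem[of x y] w by simp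
  qed
  have L2: "\<forall>u v u' v'. (u, v) \<in> L \<and> (u', v') \<in> L \<longrightarrow> \<not> sim u v'"
  proof (intro allI impI, elim conjE)
    fix u v u' v' assume "(u, v) \<in> L" "(u', v') \<in> L"
    then obtain x y x' y' where "(x, y) \<in> Q" "(x', y') \<in> Q" "u = a h x" "v' = a h' y'"
      using LE by meson
    then show "\<not> sim u v'" using h'(2)[of y' u] mem[of x y] mem[of x' y'] by simp
  qed
  have L3: "\<not> sim u u' \<and> \<not> sim v v'" if uv: "(u, v) \<in> L" "(u', v') \<in> L" "(u, v) \<noteq> (u', v')" for u v u' v'
  proof -
    obtain x y x' y' where xy: "(x, y) \<in> Q" "u = a h x" "v = a h' y"
        "(x', y') \<in> Q" "u' = a h x'" "v' = a h' y'"
      using LE[OF uv(1)] LE[OF uv(2)] by blast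
    then have "(x, y) \<noteq> (x', y')" using uv(3) by auto
    then have "x \<noteq> x'" "y \<noteq> y'" using neq[OF xy(1,4)] by blast+
    then show ?thesis
      unfolding xy(2,3,5,6)
      using h(3)[of x x'] h'(3)[of y y'] mem[OF xy(1)] mem[OF xy(4)] by blast
  qed
  then have L3': "\<forall>u v u' v'. (u, v) \<in> L \<and> (u', v') \<in> L \<and> (u, v) \<noteq> (u', v') \<longrightarrow> \<not> sim u u' \<and> \<not> sim v v'"
    by blast
  have "finite L" using Q(1) by (simp add: L_def)
  from condition_connect[OF C this c(3) k(2) L1 L2 L3'] obtain C' where C': "C \<subseteq> C'" "condition C'"
    "\<And>u v. (u, v) \<in> L \<Longrightarrow> \<exists>z. (z, u) \<in> C' \<and> (a k z, v) \<in> C'" by blast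
  \<comment> \<open>The factors send \<open>x\<close> to \<open>a h x\<close>, then via
    \<open>z\<close> and \<open>a k z\<close> to \<open>a h' y\<close>, then to \<open>y\<close>:
    \<open>h\<close> and \<open>inv h'\<close> act untwisted, \<open>k\<close> as its conjugate by
    \<open>\<sigma>\<close>.\<close>
  have "twist \<sigma> (inv h' \<otimes> (k \<otimes> h)) x = y"
    if \<sigma>: "equivariant \<sigma>" "extends \<sigma> C'" and xy: "(x, y) \<in> Q" for \<sigma> x y
  proof -
    have "(a h x, a h' y) \<in> L" using xy by (force simp: L_def)
    then obtain z where "(z, a h x) \<in> C'" "(a k z, a h' y) \<in> C'" using C'(3) by blast
    then have z: "\<sigma> z = a h x" "\<sigma> (a k z) = a h' y" using \<sigma>(2) by (auto simp: extends_def)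
    have "inj \<sigma>" using \<sigma>(1) by (simp add: equivariant_def bij_is_inj)
    then have z': "inv_into UNIV \<sigma> (a h x) = z" using z(1) by (metis inv_f_f)
    have "inv h' \<in> ?H"
      using V.stabilizer_subgroup[OF graphD(1)[OF e0]] h'(1) by (rule subgroup.m_inv_closed)
    then show ?thesis
      using twist_mult[OF \<sigma>(1)] twist_source[OF \<sigma>(1)] twist_range[OF \<sigma>(1) k(1)] h(1) c z z'
      by (simp add: a_inv)
  qed
  moreover have "inv h' \<otimes> (k \<otimes> h) \<in> carrier \<Gamma>" using c by simp
  ultimately show ?thesis using C'(1,2) by blast
qed

text \<open>Each dense set either forces one non-trivial \<open>g\<close> to act non-trivially or
  realizes one finite partial bijection \<open>Q\<close>. There are countably many of them, as
  \<Gamma> and the set of points are countable.\<close>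

lemma ex_highly_transitive_twist:
  assumes "countable (carrier \<Gamma>)"
  obtains \<sigma> where "equivariant \<sigma>" "\<And>g. \<lbrakk>g \<in> carrier \<Gamma>; g \<noteq> \<one>\<rbrakk> \<Longrightarrow> twist \<sigma> g \<noteq> id"
    "\<And>Q. \<lbrakk>finite Q; inj_on fst Q; inj_on snd Q\<rbrakk> \<Longrightarrow> \<exists>g\<in>carrier \<Gamma>. \<forall>(x, y)\<in>Q. twist \<sigma> g x = y"
proof -
  define \<F> where "\<F> g = {C. \<forall>\<sigma>. equivariant \<sigma> \<and> extends \<sigma> C \<longrightarrow> twist \<sigma> g \<noteq> id}" for g
  define \<T> where "\<T> Q = {C. \<exists>g\<in>carrier \<Gamma>. \<forall>\<sigma>. equivariant \<sigma> \<and> extends \<sigma> C \<longrightarrow> (\<forall>(x, y)\<in>Q. twist \<sigma> g x = y)}" for Q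
  define \<Q> where "\<Q> = {Q :: ('x \<times> 'x) set. finite Q \<and> inj_on fst Q \<and> inj_on snd Q}"
  have "countable \<Q>"
    unfolding \<Q>_def by (rule countable_subset[OF _ countable_Collect_finite]) blast
  then have count: "countable (\<F> ` (carrier \<Gamma> - {\<one>}) \<union> \<T> ` \<Q>)" using assms by simp
  have "\<exists>C'\<in>D. C \<subseteq> C' \<and> condition C'"
    if "D \<in> \<F> ` (carrier \<Gamma> - {\<one>}) \<union> \<T> ` \<Q>" "condition C" for D C
    using that(1)
  proof
    assume "D \<in> \<F> ` (carrier \<Gamma> - {\<one>})"
    then obtain g where "D = \<F> g" "g \<in> carrier \<Gamma>" "g \<noteq> \<one>" by blast
    then show ?thesis using faithful_dense[OF that(2), of g] unfolding \<F>_def by blast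
  next
    assume "D \<in> \<T> ` \<Q>"
    then obtain Q where "D = \<T> Q" "finite Q" "inj_on fst Q" "inj_on snd Q" by (auto simp: \<Q>_def)
    then show ?thesis using transitive_dense[OF that(2), of Q] unfolding \<T>_def by blast
  qed
  then have "\<forall>D\<in>\<F> ` (carrier \<Gamma> - {\<one>}) \<union> \<T> ` \<Q>. \<forall>C. condition C
      \<longrightarrow> (\<exists>C'\<in>D. C \<subseteq> C' \<and> condition C')"
    by (intro ballI allI impI)
  from generic_equivariant[OF count this] obtain \<sigma> where \<sigma>: "equivariant \<sigma>"
    "\<forall>D\<in>\<F> ` (carrier \<Gamma> - {\<one>}) \<union> \<T> ` \<Q>. \<exists>C\<in>D. extends \<sigma> C"
    by (elim exE conjE)
  show ?thesis
  proof (rule that[OF \<sigma>(1)])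
    fix g assume "g \<in> carrier \<Gamma>" "g \<noteq> \<one>"
    then have "\<exists>C\<in>\<F> g. extends \<sigma> C" using \<sigma>(2) by blast
    then show "twist \<sigma> g \<noteq> id" using \<sigma>(1) by (auto simp: \<F>_def)
  next
    fix Q :: "('x \<times> 'x) set" assume "finite Q" "inj_on fst Q" "inj_on snd Q"
    then have "\<exists>C\<in>\<T> Q. extends \<sigma> C" using \<sigma>(2) unfolding \<Q>_def by blast
    then obtain C g where "extends \<sigma> C" "g \<in> carrier \<Gamma>"
      "\<forall>\<sigma>. equivariant \<sigma> \<and> extends \<sigma> C \<longrightarrow> (\<forall>(x, y)\<in>Q. twist \<sigma> g x = y)"
      unfolding \<T>_def mem_Collect_eq by (elim bexE CollectE)
    then show "\<exists>g\<in>carrier \<Gamma>. \<forall>(x, y)\<in>Q. twist \<sigma> g x = y" using \<sigma>(1) by meson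
  qed
qed

end

section \<open>Highly core-free subgroups\<close>

text \<open>Let \<open>S k\<close> be the set of elements conjugating \<open>k\<close> into
  \<Sigma>; then \<open>k\<close> lies in the core of \<Sigma> over \<open>S k\<close>. If
  separation failed, the non-empty \<open>S k\<close> would cover everything outside the product of
  \<Sigma> and \<open>F\<close>, so one of these cores would be trivial although its
  \<open>k\<close> is not.\<close>

lemma highly_core_free_separating:
  assumes "group H" "infinite (carrier H)" "highly_core_free \<Sigma> H"
  shows "separating H \<Sigma> (carrier H)"
  unfolding separating_def
proof (intro allI impI, rule ccontr)
  interpret group H by fact
  fix F K
  assume FK: "finite F \<and> F \<subseteq> carrier H \<and> finite K \<and> K \<subseteq> carrier H \<and> \<one>\<^bsub>H\<^esub> \<notin> K"
    and "\<not> (\<exists>h\<in>carrier H. h \<notin> \<Sigma> <#>\<^bsub>H\<^esub> F \<and> (\<forall>k\<in>K. h \<otimes>\<^bsub>H\<^esub> k \<otimes>\<^bsub>H\<^esub> inv\<^bsub>H\<^esub> h \<notin> \<Sigma>))"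
  then have cover: "\<exists>k\<in>K. h \<otimes>\<^bsub>H\<^esub> k \<otimes>\<^bsub>H\<^esub> inv\<^bsub>H\<^esub> h \<in> \<Sigma>"
    if "h \<in> carrier H" "h \<notin> \<Sigma> <#>\<^bsub>H\<^esub> F" for h
    using that by blast
  have \<Sigma>: "subgroup \<Sigma> H" using assms(3) by (simp add: highly_core_free_def)
  have core: "\<exists>k\<in>{1..n}. Core H (S k) \<Sigma> = {\<one>\<^bsub>H\<^esub>}"
    if "n \<ge> 1" "\<And>k. k \<in> {1..n} \<Longrightarrow> S k \<noteq> {} \<and> S k \<subseteq> carrier H"
      "carrier H - (\<Sigma> <#>\<^bsub>H\<^esub> F) \<subseteq> (\<Union>k\<in>{1..n}. S k)" for n :: nat and S
    using assms(3)[unfolded highly_core_free_def] FK that by (metis (no_types, lifting))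
  define S where "S k = {h \<in> carrier H. h \<otimes>\<^bsub>H\<^esub> k \<otimes>\<^bsub>H\<^esub> inv\<^bsub>H\<^esub> h \<in> \<Sigma>}" for k
  define K' where "K' = {k \<in> K. S k \<noteq> {}}"
  have K': "finite K'" using FK by (simp add: K'_def)
  have cover': "carrier H - (\<Sigma> <#>\<^bsub>H\<^esub> F) \<subseteq> (\<Union>k\<in>K'. S k)"
    using cover by (fastforce simp: K'_def S_def)
  show False
  proof (cases "K' = {}")
    \<comment> \<open>The product of \<Sigma> and \<open>F\<close> is then the whole group, so the
      single set consisting of the identity is an admissible family. Its core is \<Sigma>, hence
      \<Sigma> is trivial and the group lies in the finite set \<open>F\<close>.\<close>
    case True
    then have car: "carrier H \<subseteq> \<Sigma> <#>\<^bsub>H\<^esub> F" using cover' by blast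
    have "Core H {\<one>\<^bsub>H\<^esub>} \<Sigma> = \<Sigma>"
      using subgroup.mem_carrier[OF \<Sigma>] by (force simp: Core_def)
    moreover have "Core H {\<one>\<^bsub>H\<^esub>} \<Sigma> = {\<one>\<^bsub>H\<^esub>}"
      using core[of 1 "\<lambda>_. {\<one>\<^bsub>H\<^esub>}"] car by auto
    ultimately have "carrier H \<subseteq> F" using car FK by (auto simp: set_mult_def subset_iff)
    then show False using assms(2) FK finite_subset by blast
  next
    case False
    obtain f where f: "bij_betw f {1..card K'} K'"
      using ex_bij_betw_nat_finite_1[OF K'] by blast
    have fK: "f ` {1..card K'} = K'" using f by (rule bij_betw_imp_surj_on)
    have "\<exists>k\<in>{1..card K'}. Core H (S (f k)) \<Sigma> = {\<one>\<^bsub>H\<^esub>}"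
    proof (rule core)
      show "1 \<le> card K'" using K' False by (simp add: Suc_le_eq card_gt_0_iff)
      show "S (f k) \<noteq> {} \<and> S (f k) \<subseteq> carrier H" if "k \<in> {1..card K'}" for k
        using fK that by (auto simp: K'_def S_def)
      show "carrier H - (\<Sigma> <#>\<^bsub>H\<^esub> F) \<subseteq> (\<Union>k\<in>{1..card K'}. S (f k))"
      proof -
        have "(\<Union>k\<in>{1..card K'}. S (f k)) = (\<Union>k\<in>f ` {1..card K'}. S k)" by simp
        then show ?thesis using cover' unfolding fK by simp
      qed
    qed
    then obtain k where k: "k \<in> K'" "Core H (S k) \<Sigma> = {\<one>\<^bsub>H\<^esub>}" using fK by blast
    have kH: "k \<in> carrier H" "k \<noteq> \<one>\<^bsub>H\<^esub>" using k(1) FK by (auto simp: K'_def)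
    have "k \<in> Core H (S k) \<Sigma>"
      unfolding Core_def
    proof
      fix h assume "h \<in> S k"
      then have h: "h \<in> carrier H" "h \<otimes>\<^bsub>H\<^esub> k \<otimes>\<^bsub>H\<^esub> inv\<^bsub>H\<^esub> h \<in> \<Sigma>" by (auto simp: S_def)
      have "k = inv\<^bsub>H\<^esub> h \<otimes>\<^bsub>H\<^esub> (h \<otimes>\<^bsub>H\<^esub> k \<otimes>\<^bsub>H\<^esub> inv\<^bsub>H\<^esub> h) \<otimes>\<^bsub>H\<^esub> h"
        using h(1) kH(1) by (simp add: m_assoc) (simp add: m_assoc[symmetric])
      then show "k \<in> {inv\<^bsub>H\<^esub> h \<otimes>\<^bsub>H\<^esub> s \<otimes>\<^bsub>H\<^esub> h |s. s \<in> \<Sigma>}" using h(2) by blast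
    qed
    then show False using k(2) kH(2) by simp
  qed
qed

text \<open>Carries the property from an abstract vertex group to a stabilizer; injectivity of
  \<open>\<phi>\<close> keeps the preimages of \<open>F\<close> and \<open>K\<close> finite.\<close>

lemma separating_iso:
  assumes H: "group H" and \<Gamma>: "group \<Gamma>" and L: "subgroup L \<Gamma>"
    and \<phi>: "\<phi> \<in> iso H (\<Gamma>\<lparr>carrier := L\<rparr>)" and \<Sigma>: "\<Sigma> \<subseteq> carrier H"
    and sep: "separating H \<Sigma> (carrier H)"
  shows "separating \<Gamma> (\<phi> ` \<Sigma>) L"
  unfolding separating_def
proof (intro allI impI)
  fix F K assume FK: "finite F \<and> F \<subseteq> L \<and> finite K \<and> K \<subseteq> L \<and> \<one>\<^bsub>\<Gamma>\<^esub> \<notin> K"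
  interpret H: group H by fact
  interpret \<Gamma>: group \<Gamma> by fact
  interpret hom: group_hom H "\<Gamma>\<lparr>carrier := L\<rparr>" \<phi>
    using H subgroup.subgroup_is_group[OF L \<Gamma>] \<phi>
    by (simp add: group_hom_def group_hom_axioms_def iso_def)
  have bij: "bij_betw \<phi> (carrier H) L" using \<phi> by (simp add: iso_def)
  then have inj: "inj_on \<phi> (carrier H)" by (rule bij_betw_imp_inj_on)
  have mult: "\<phi> (x \<otimes>\<^bsub>H\<^esub> y) = \<phi> x \<otimes>\<^bsub>\<Gamma>\<^esub> \<phi> y" if "x \<in> carrier H" "y \<in> carrier H" for x y
    using hom.hom_mult[OF that] by simp
  have \<phi>_inv: "\<phi> (inv\<^bsub>H\<^esub> x) = inv\<^bsub>\<Gamma>\<^esub> \<phi> x" if "x \<in> carrier H" for x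
    using hom.hom_inv[OF that] \<Gamma>.m_inv_consistent[OF L] bij that by (auto simp: bij_betw_def)
  define F' K' where "F' = {x \<in> carrier H. \<phi> x \<in> F}" and "K' = {x \<in> carrier H. \<phi> x \<in> K}"
  have fin: "finite F'" "finite K'"
    using finite_vimage_IntI[OF _ inj] FK by (simp_all add: F'_def K'_def vimage_def Int_def conj_commute)
  moreover have "F' \<subseteq> carrier H" "K' \<subseteq> carrier H" "\<one>\<^bsub>H\<^esub> \<notin> K'"
    using FK hom.hom_one by (auto simp: F'_def K'_def)
  ultimately obtain h where h: "h \<in> carrier H" "h \<notin> \<Sigma> <#>\<^bsub>H\<^esub> F'"
    "\<And>k. k \<in> K' \<Longrightarrow> h \<otimes>\<^bsub>H\<^esub> k \<otimes>\<^bsub>H\<^esub> inv\<^bsub>H\<^esub> h \<notin> \<Sigma>"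
    using sep[unfolded separating_def, rule_format, of F' K'] by blast
  have pre: "\<exists>x\<in>carrier H. \<phi> x = y" if "y \<in> L" for y
    using bij that by (auto simp: bij_betw_def)
  show "\<exists>h\<in>L. h \<notin> \<phi> ` \<Sigma> <#>\<^bsub>\<Gamma>\<^esub> F \<and> (\<forall>k\<in>K. h \<otimes>\<^bsub>\<Gamma>\<^esub> k \<otimes>\<^bsub>\<Gamma>\<^esub> inv\<^bsub>\<Gamma>\<^esub> h \<notin> \<phi> ` \<Sigma>)"
  proof (intro bexI conjI ballI)
    show "\<phi> h \<in> L" using bij h(1) by (auto simp: bij_betw_def)
    show "\<phi> h \<notin> \<phi> ` \<Sigma> <#>\<^bsub>\<Gamma>\<^esub> F"
    proof
      assume "\<phi> h \<in> \<phi> ` \<Sigma> <#>\<^bsub>\<Gamma>\<^esub> F"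
      then obtain s f where sf: "s \<in> \<Sigma>" "f \<in> F" "\<phi> h = \<phi> s \<otimes>\<^bsub>\<Gamma>\<^esub> f" by (auto simp: set_mult_def)
      obtain f' where f': "f' \<in> carrier H" "\<phi> f' = f" using pre sf(2) FK by blast
      have s: "s \<in> carrier H" using \<Sigma> sf(1) by blast
      have "\<phi> h = \<phi> (s \<otimes>\<^bsub>H\<^esub> f')" using sf(3) f' mult[OF s f'(1)] by simp
      then have "h = s \<otimes>\<^bsub>H\<^esub> f'" using inj_onD[OF inj _ h(1) H.m_closed[OF s f'(1)]] by blast
      then show False using h(2) sf f' by (auto simp: set_mult_def F'_def)
    qed
    fix k assume k: "k \<in> K"
    obtain k' where k': "k' \<in> carrier H" "\<phi> k' = k" using pre k FK by blast
    show "\<phi> h \<otimes>\<^bsub>\<Gamma>\<^esub> k \<otimes>\<^bsub>\<Gamma>\<^esub> inv\<^bsub>\<Gamma>\<^esub> \<phi> h \<notin> \<phi> ` \<Sigma>"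
    proof
      assume "\<phi> h \<otimes>\<^bsub>\<Gamma>\<^esub> k \<otimes>\<^bsub>\<Gamma>\<^esub> inv\<^bsub>\<Gamma>\<^esub> \<phi> h \<in> \<phi> ` \<Sigma>"
      then have "\<phi> (h \<otimes>\<^bsub>H\<^esub> k' \<otimes>\<^bsub>H\<^esub> inv\<^bsub>H\<^esub> h) \<in> \<phi> ` \<Sigma>"
        using h(1) k' by (simp add: mult \<phi>_inv del: hom.hom_inv)
      then have "h \<otimes>\<^bsub>H\<^esub> k' \<otimes>\<^bsub>H\<^esub> inv\<^bsub>H\<^esub> h \<in> \<Sigma>"
        using inj_on_image_mem_iff[OF inj _ \<Sigma>] h(1) k'(1)
        by (simp del: hom.hom_inv hom.hom_mult)
      then show False using h(3)[of k'] k k' by (simp add: K'_def)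
    qed
  qed
qed

section \<open>A free action with infinitely many orbits\<close>

lemma (in group) ex_free_action_nat:
  assumes "countable (carrier G)"
  obtains a :: "'a \<Rightarrow> nat \<Rightarrow> nat"
  where "\<And>x. a \<one> x = x"
    "\<And>g h x. \<lbrakk>g \<in> carrier G; h \<in> carrier G\<rbrakk> \<Longrightarrow> a (g \<otimes> h) x = a g (a h x)"
    "\<And>g x. \<lbrakk>g \<in> carrier G; a g x = x\<rbrakk> \<Longrightarrow> g = \<one>"
    "\<And>F. finite F \<Longrightarrow> \<exists>z. \<forall>y\<in>F. \<forall>g\<in>carrier G. a g y \<noteq> z"
proof -
  have "infinite (carrier G \<times> (UNIV :: nat set))"
    using carrier_not_empty by (auto dest: finite_cartesian_productD2)
  then obtain f where f: "bij_betw f (carrier G \<times> (UNIV :: nat set)) (UNIV :: nat set)"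
    using assms by (metis countableE_infinite countable_SIGMA countableI_type)
  then have inj: "inj_on f (carrier G \<times> UNIV)" by (rule bij_betw_imp_inj_on)
  define r where "r = inv_into (carrier G \<times> (UNIV :: nat set)) f"
  have rf: "r (f (g, i)) = (g, i)" if "g \<in> carrier G" for g i
    using that by (simp add: r_def inv_into_f_f[OF inj])
  have ex: "\<exists>g\<in>carrier G. \<exists>i. x = f (g, i)" for x
    using bij_betw_imp_surj_on[OF f] by (metis (no_types, lifting) SigmaE UNIV_I imageE)
  define a where "a g x = f (g \<otimes> fst (r x), snd (r x))" for g x
  have af: "a g (f (h, i)) = f (g \<otimes> h, i)" if "h \<in> carrier G" for g h i
    using that by (simp add: a_def rf)
  have f_inj: "f (g, i) = f (h, j) \<longleftrightarrow> g = h \<and> i = j" if "g \<in> carrier G" "h \<in> carrier G" for g h i j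
    using inj_onD[OF inj, of "(g, i)" "(h, j)"] that by auto
  show ?thesis
  proof (rule that)
    show "a \<one> x = x" for x using ex[of x] af by auto
    show "a (g \<otimes> h) x = a g (a h x)" if "g \<in> carrier G" "h \<in> carrier G" for g h x
      using ex[of x] that by (auto simp: af m_assoc)
    show "g = \<one>" if "g \<in> carrier G" "a g x = x" for g x
      using ex[of x] that by (auto simp: af f_inj)
    show "\<exists>z. \<forall>y\<in>F. \<forall>g\<in>carrier G. a g y \<noteq> z" if fin: "finite F" for F
    proof -
      obtain m where m: "m \<notin> (snd \<circ> r) ` F"
        using ex_new_if_finite[OF infinite_UNIV_nat finite_imageI[OF fin]] by blast
      have "a g y \<noteq> f (\<one>, m)" if y: "y \<in> F" and g: "g \<in> carrier G" for y g
      proof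
        assume *: "a g y = f (\<one>, m)"
        obtain h i where h: "h \<in> carrier G" "y = f (h, i)" using ex by blast
        then have "i = m" using * g by (simp add: af f_inj)
        then have "snd (r y) = m" using h rf by simp
        then show False using m y by force
      qed
      then show ?thesis by blast
    qed
  qed
qed

section \<open>Application to the given action on a tree\<close>

theorem theorem4p1:
  fixes \<Gamma> :: "'g monoid"
    and X :: "('v, 'e) sgraph"
    and \<alpha> :: "'g \<Rightarrow> 'v \<Rightarrow> 'v"
    and \<beta> :: "'g \<Rightarrow> 'e \<Rightarrow> 'e"
    and \<G> :: "('v set, 'e set, 'h, 'k) gog"
  assumes "group \<Gamma>" and "countable (carrier \<Gamma>)"
    and "nontrivial_tree X"
    and "acts_on_graph \<Gamma> X \<alpha> \<beta>" and "without_inversion \<Gamma> X \<beta>"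
    and "associated_graph_of_groups \<Gamma> X \<alpha> \<beta> \<G>"
    and "\<forall>p\<in>verts (quotient_graph \<Gamma> X \<alpha> \<beta>). infinite (carrier (vgrp \<G> p))"
    and "\<forall>e\<in>edges (quotient_graph \<Gamma> X \<alpha> \<beta>).
           highly_core_free (smap \<G> e ` carrier (egrp \<G> e))
             (vgrp \<G> (src (quotient_graph \<Gamma> X \<alpha> \<beta>) e))"
  shows "\<exists>(A :: nat set) \<psi>. infinite A \<and> countable A \<and> group_action \<Gamma> A \<psi>
           \<and> faithful_action \<Gamma> A \<psi> \<and> highly_transitive \<Gamma> A \<psi>"
proof -
  define Y where "Y = quotient_graph \<Gamma> X \<alpha> \<beta>"
  obtain T v x t \<phi> where gog: "graph_of_groups Y \<G>" and data: "bass_serre_data \<Gamma> X \<alpha> \<beta> \<G> T v x t \<phi>"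
    using assms(6) by (auto simp: associated_graph_of_groups_def Let_def Y_def)
  interpret group \<Gamma> by fact
  have Y: "serre_graph Y" using gog by (simp add: graph_of_groups_def)
  have vdata: "v p \<in> p \<and> \<phi> p \<in> iso (vgrp \<G> p) (\<Gamma>\<lparr>carrier := stabilizer \<Gamma> \<alpha> (v p)\<rparr>)"
    if "p \<in> verts Y" for p
    using data that by (simp add: bass_serre_data_def Let_def Y_def)
  have edata: "x d \<in> d \<and> t d \<in> carrier \<Gamma> \<and> src X (x d) = v (src Y d)
      \<and> rng X (x d) = \<alpha> (t d) (v (rng Y d)) \<and> x (einv Y d) = \<beta> (inv\<^bsub>\<Gamma>\<^esub> t d) (einv X (x d))
      \<and> \<phi> (src Y d) \<circ> smap \<G> d \<in> iso (egrp \<G> d) (\<Gamma>\<lparr>carrier := stabilizer \<Gamma> \<beta> (x d)\<rparr>)"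
    if "d \<in> edges Y" for d
    using data that by (simp add: bass_serre_data_def Let_def Y_def)
  have sub: "src X e \<in> verts X" if "e \<in> edges X" for e
    using assms(3) serre_graphD(1)[OF _ that] by (auto simp: nontrivial_tree_def gtree_def)
  have V: "group_action \<Gamma> (verts X) \<alpha>" and E: "group_action \<Gamma> (edges X) \<beta>"
    using assms(4) by (auto simp: acts_on_graph_def)
  have x_edge: "x d \<in> edges X" if "d \<in> edges Y" for d
  proof -
    have "d \<in> orbits \<Gamma> (edges X) \<beta>" using that by (simp add: Y_def quotient_graph_def)
    then obtain e where e: "e \<in> edges X" "d = orbit \<Gamma> \<beta> e" unfolding orbits_def by blast
    have "x d \<in> orbit \<Gamma> \<beta> e" using edata[OF that] e(2) by blast
    then obtain g where "g \<in> carrier \<Gamma>" "\<beta> g e = x d" unfolding orbit_def by auto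
    then show ?thesis by (rule group_action.element_image[OF E _ e(1)])
  qed
  \<comment> \<open>\<open>\<phi>\<close> identifies the vertex group with the stabilizer of the
    source of \<open>x d\<close>, and the image of the edge group with the stabilizer of
    \<open>x d\<close>.\<close>
  have sep: "separating \<Gamma> (stabilizer \<Gamma> \<beta> (x d)) (stabilizer \<Gamma> \<alpha> (src X (x d)))"
    if d: "d \<in> edges Y" for d
  proof -
    let ?H = "vgrp \<G> (src Y d)" and ?\<Sigma> = "smap \<G> d ` carrier (egrp \<G> d)"
    have H: "group ?H" "src Y d \<in> verts Y"
      using gog serre_graphD(1)[OF Y d] by (auto simp: graph_of_groups_def)
    have "separating ?H ?\<Sigma> (carrier ?H)"
      using assms(7,8) d H by (intro highly_core_free_separating) (auto simp: Y_def)
    moreover have "?\<Sigma> \<subseteq> carrier ?H"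
      using gog d by (auto simp: graph_of_groups_def hom_def)
    moreover have "subgroup (stabilizer \<Gamma> \<alpha> (src X (x d))) \<Gamma>"
      using group_action.stabilizer_subgroup[OF V] sub x_edge[OF d] by blast
    ultimately have "separating \<Gamma> (\<phi> (src Y d) ` ?\<Sigma>) (stabilizer \<Gamma> \<alpha> (src X (x d)))"
      using separating_iso[OF H(1) assms(1)] vdata[OF H(2)] edata[OF d] by simp
    moreover have "\<phi> (src Y d) ` ?\<Sigma> = stabilizer \<Gamma> \<beta> (x d)"
      using edata[OF d] by (auto simp: iso_def bij_betw_def image_comp)
    ultimately show ?thesis by simp
  qed
  \<comment> \<open>The representative \<open>x d\<close> of any edge of the quotient serves as the
    fixed edge \<open>e0\<close>.\<close>
  obtain d where d: "d \<in> edges Y"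
    using assms(3) by (auto simp: nontrivial_tree_def Y_def quotient_graph_def orbits_def)
  obtain a :: "'g \<Rightarrow> nat \<Rightarrow> nat" where a:
    "\<And>x. a \<one>\<^bsub>\<Gamma>\<^esub> x = x"
    "\<And>g h x. \<lbrakk>g \<in> carrier \<Gamma>; h \<in> carrier \<Gamma>\<rbrakk> \<Longrightarrow> a (g \<otimes>\<^bsub>\<Gamma>\<^esub> h) x = a g (a h x)"
    "\<And>g x. \<lbrakk>g \<in> carrier \<Gamma>; a g x = x\<rbrakk> \<Longrightarrow> g = \<one>\<^bsub>\<Gamma>\<^esub>"
    "\<And>F. finite F \<Longrightarrow> \<exists>z. \<forall>y\<in>F. \<forall>g\<in>carrier \<Gamma>. a g y \<noteq> z"
    using ex_free_action_nat[OF assms(2)] by blast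
  interpret twisted_tree_action \<Gamma> a \<beta> "x d" X \<alpha>
  proof (intro twisted_tree_action.intro free_action_subgroup.intro twisted_tree_action_axioms.intro
      free_action_subgroup_axioms.intro)
    show "subgroup (stabilizer \<Gamma> \<beta> (x d)) \<Gamma>"
      using group_action.stabilizer_subgroup[OF E] x_edge[OF d] by blast
    show "gtree X" using assms(3) by (simp add: nontrivial_tree_def)
    show "\<beta> g (x d) \<noteq> einv X (x d)" if "g \<in> carrier \<Gamma>" for g
      using assms(5) x_edge[OF d] that by (simp add: without_inversion_def)
  qed (fact a assms(1,4) x_edge[OF d])+
  \<comment> \<open>Separation at the inverse edge \<open>?d\<close> gives \<open>h\<close> fixing
    the source of \<open>x ?d\<close> but not \<open>x ?d\<close>. As \<open>t d\<close> moves
    \<open>x ?d\<close> to the inverse of \<open>x d\<close>, the conjugate \<open>k\<close> of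
    \<open>h\<close> by \<open>t d\<close> fixes the range of \<open>x d\<close> but not
    \<open>x d\<close>.\<close>
  have not_sub: "\<not> stabilizer \<Gamma> \<alpha> (rng X (x d)) \<subseteq> stabilizer \<Gamma> \<beta> (x d)"
  proof -
    let ?d = "einv Y d" and ?t = "t d"
    note D = edata[OF d]
    have d': "?d \<in> edges Y" "src Y ?d = rng Y d" using serre_graphD[OF Y d] by auto
    have t: "?t \<in> carrier \<Gamma>" using D by blast
    \<comment> \<open>With \<open>F\<close> reduced to the identity and \<open>K\<close> empty,
      separation asks only for an element outside the edge stabilizer.\<close>
    obtain h where h: "h \<in> stabilizer \<Gamma> \<alpha> (src X (x ?d))"
        "h \<notin> stabilizer \<Gamma> \<beta> (x ?d) <#>\<^bsub>\<Gamma>\<^esub> {\<one>\<^bsub>\<Gamma>\<^esub>}"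
      using sep[OF d'(1), unfolded separating_def, rule_format, of "{\<one>\<^bsub>\<Gamma>\<^esub>}" "{}"]
        group_action.stabilizer_one_closed[OF V sub[OF x_edge[OF d'(1)]]] by auto
    have hc: "h \<in> carrier \<Gamma>" and hv: "\<alpha> h (v (rng Y d)) = v (rng Y d)"
      using h(1) edata[OF d'(1)] d'(2) by (auto simp: stabilizer_def)
    have hx: "\<beta> h (x ?d) \<noteq> x ?d"
      using h(2) hc by (force simp: set_mult_def stabilizer_def)
    define k where "k = ?t \<otimes>\<^bsub>\<Gamma>\<^esub> h \<otimes>\<^bsub>\<Gamma>\<^esub> inv\<^bsub>\<Gamma>\<^esub> ?t"
    have k: "k \<in> carrier \<Gamma>" using t hc by (simp add: k_def)
    have "v (rng Y d) \<in> verts X"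
      using edata[OF d'(1)] d'(2) sub[OF x_edge[OF d'(1)]] by simp
    then have "\<alpha> k (\<alpha> ?t (v (rng Y d))) = \<alpha> ?t (\<alpha> h (v (rng Y d)))"
      using t hc by (simp add: V.composition_rule[symmetric] k_def m_assoc)
    then have "k \<in> stabilizer \<Gamma> \<alpha> (rng X (x d))"
      using D hv k by (simp add: stabilizer_def)
    moreover have "k \<notin> stabilizer \<Gamma> \<beta> (x d)"
    proof
      assume "k \<in> stabilizer \<Gamma> \<beta> (x d)"
      then have kx: "\<beta> k (einv X (x d)) = einv X (x d)"
        using \<beta>_graph(3)[OF k x_edge[OF d]] by (simp add: stabilizer_def)
      have ie: "einv X (x d) \<in> edges X" using graphD(3)[OF x_edge[OF d]] .
      have "inv\<^bsub>\<Gamma>\<^esub> ?t \<otimes>\<^bsub>\<Gamma>\<^esub> k = h \<otimes>\<^bsub>\<Gamma>\<^esub> inv\<^bsub>\<Gamma>\<^esub> ?t"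
        using t hc by (simp add: k_def m_assoc[symmetric])
      then have "\<beta> h (\<beta> (inv\<^bsub>\<Gamma>\<^esub> ?t) (einv X (x d))) = \<beta> (inv\<^bsub>\<Gamma>\<^esub> ?t) (\<beta> k (einv X (x d)))"
        using t hc k ie by (simp add: E.composition_rule[symmetric])
      then show False using hx D kx by simp
    qed
    ultimately show ?thesis by blast
  qed
  interpret separated_tree_action \<Gamma> a \<beta> "x d" X \<alpha>
    by unfold_locales (use sep[OF d] not_sub in auto)
  obtain \<sigma> where \<sigma>: "equivariant \<sigma>"
    and faithful: "\<And>g. \<lbrakk>g \<in> carrier \<Gamma>; g \<noteq> \<one>\<^bsub>\<Gamma>\<^esub>\<rbrakk> \<Longrightarrow> twist \<sigma> g \<noteq> id"
    and trans: "\<And>Q. \<lbrakk>finite Q; inj_on fst Q; inj_on snd Q\<rbrakk>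
      \<Longrightarrow> \<exists>g\<in>carrier \<Gamma>. \<forall>(x, y)\<in>Q. twist \<sigma> g x = y"
    using ex_highly_transitive_twist[OF assms(2)] by blast
  have twist_inv: "twist \<sigma> g \<circ> twist \<sigma> (inv\<^bsub>\<Gamma>\<^esub> g) = id" "twist \<sigma> (inv\<^bsub>\<Gamma>\<^esub> g) \<circ> twist \<sigma> g = id"
    if "g \<in> carrier \<Gamma>" for g
    using that by (simp_all add: twist_mult[OF \<sigma>, symmetric] twist_one[OF \<sigma>])
  have action: "group_action \<Gamma> UNIV (twist \<sigma>)"
  proof -
    have "twist \<sigma> g \<in> Bij UNIV" if "g \<in> carrier \<Gamma>" for g
      using o_bij[OF twist_inv(2,1)[OF that]] by (simp add: Bij_def)
    then have "twist \<sigma> \<in> hom \<Gamma> (BijGroup UNIV)"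
      by (auto simp: hom_def BijGroup_def twist_mult[OF \<sigma>] compose_def fun_eq_iff)
    then show ?thesis
      by (simp add: group_action_def group_hom_def group_hom_axioms_def group_BijGroup assms(1))
  qed
  moreover have "faithful_action \<Gamma> UNIV (twist \<sigma>)"
  proof (intro faithful_action.intro action faithful_action_axioms.intro inj_onI)
    fix g h assume gh: "g \<in> carrier \<Gamma>" "h \<in> carrier \<Gamma>" "twist \<sigma> g = twist \<sigma> h"
    then have "twist \<sigma> (inv\<^bsub>\<Gamma>\<^esub> h \<otimes>\<^bsub>\<Gamma>\<^esub> g) = id" by (simp add: twist_mult[OF \<sigma>] twist_inv)
    then have "inv\<^bsub>\<Gamma>\<^esub> h \<otimes>\<^bsub>\<Gamma>\<^esub> g = \<one>\<^bsub>\<Gamma>\<^esub>" using faithful[of "inv\<^bsub>\<Gamma>\<^esub> h \<otimes>\<^bsub>\<Gamma>\<^esub> g"] gh(1,2) by auto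
    then show "g = h" using gh by (metis inv_equality inv_inv inv_closed)
  qed
  moreover have "highly_transitive \<Gamma> UNIV (twist \<sigma>)"
    unfolding highly_transitive_def
  proof (intro conjI action allI impI)
    fix n :: nat and x y :: "nat \<Rightarrow> nat"
    assume *: "inj_on x {1..n} \<and> x ` {1..n} \<subseteq> UNIV \<and> inj_on y {1..n} \<and> y ` {1..n} \<subseteq> UNIV"
    \<comment> \<open>Injectivity of both tuples makes \<open>?Q\<close> the graph of a finite
      partial bijection.\<close>
    let ?Q = "(\<lambda>k. (x k, y k)) ` {1..n}"
    have "inj_on fst ?Q" "inj_on snd ?Q"
      using * by (auto intro!: inj_on_imageI simp: comp_def)
    from trans[OF finite_imageI[OF finite_atLeastAtMost] this]
    show "\<exists>g\<in>carrier \<Gamma>. \<forall>k\<in>{1..n}. twist \<sigma> g (x k) = y k" by simp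
  qed
  ultimately show ?thesis
    by (intro exI[of _ UNIV] exI[of _ "twist \<sigma>"]) simp
qed

end
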